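(* Let $L,M,N$ be positive integers varying so that $L+M+N\to\infty$, and assume $\lim_{L+M+N\to\infty}(L+M)/N=\infty$. Given $k\in\{1,\ldots,N\}$, let $$\rho=2\big(M\psi'(N-k+1)+L\psi'(k)\big)^{-\frac12}$$ and, with $\theta\in(-\pi,\pi]$, $$z_j=e^{\frac12\left(M\psi(N-k+1)-L\psi(k)\right)+\frac{v_j}{\rho}}\,e^{i(\theta+\phi_j)},\qquad j=1,\ldots,n.$$ Then the $n$-point correlation functions $R^{(n)}_{M,N}$ of the eigenvalues of $\Pi_M=(Y_L\cdots Y_1)^{-1}X_M\cdots X_1$ (all factors i.i.d. $N\times N$ complex Ginibre matrices) satisfy $$\lim_{L+M+N\to\infty}\rho^{-n}|z_1\cdots z_n|^2R^{(n)}_{M,N}(z_1,\ldots,z_n)=\begin{cases}\dfrac{1}{(\sqrt{2\pi})^3}\,e^{-\frac12v_1^2},& n=1,\\[1ex]0,& n>1,\end{cases}$$ uniformly for $v_1,\ldots,v_n$ in a compact subset of $\mathbb R$ and $\phi_1,\ldots,\phi_n\in(-\pi,\pi]$.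
   Context: $\psi(z)=\Gamma'(z)/\Gamma(z)$ is the digamma function and $\psi'$ its derivative; $n\ge1$ is a fixed integer. $N$ may stay bounded or tend to infinity, and $k$ may vary with $L,M,N$. Model: $X_1,\ldots,X_M,Y_1,\ldots,Y_L$ are i.i.d. complex Ginibre matrices of size $N\times N$, i.e. each has i.i.d. standard complex Gaussian entries, and $\Pi_M=(Y_L\cdots Y_1)^{-1}X_M\cdots X_1$. The eigenvalues of $\Pi_M$ form a determinantal point process in $\mathbb C$ (with respect to Lebesgue measure), with correlation functions $R^{(n)}_{M,N}(z_1,\ldots,z_n)=\det[K_{M,N}(z_i,z_j)]_{i,j=1}^n$, where $$K_{M,N}(z_1,z_2)=\frac1\pi\sqrt{w(z_1)w(z_2)}\sum_{j=0}^{N-1}\frac{(z_1\overline z_2)^j}{\Gamma^M(j+1)\Gamma^L(N-j)},\qquad w(z)=\int_{-c-i\infty}^{-c+i\infty}\frac{ds}{2\pi i}\,\Gamma^M(-s)\,\Gamma^L(N+s+1)\,|z|^{2s}$$ with $c\in(0,N+1)$. *)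

theory Defs
  imports
    "HOL-Probability.Probability"
    "Jordan_Normal_Form.Gauss_Jordan_Elimination"
    "Jordan_Normal_Form.Char_Poly"
begin

text \<open>The random matrix model. It is realised on its canonical sample space: a sample is a pair
  \<open>\<omega>\<close>, where \<open>fst \<omega> (m, a, b)\<close> is the entry in position \<open>(a, b)\<close> of \<open>X\<^sub>m\<close> for \<open>m \<in> {1..M}\<close>, and
  \<open>snd \<omega> (l, a, b)\<close> is the corresponding entry of \<open>Y\<^sub>l\<close> for \<open>l \<in> {1..L}\<close>. All entries are
  independent standard complex Gaussians (mean 0, \<open>E \<bar>\<xi>\<bar>\<^sup>2 = 1\<close>).\<close>

definition std_complex_gaussian :: "complex measure" where
  "std_complex_gaussian = density lborel (\<lambda>\<xi>. ennreal (exp (- (cmod \<xi>)\<^sup>2) / pi))"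

definition ginibre_space ::
  "nat \<Rightarrow> nat \<Rightarrow> nat \<Rightarrow> ((nat \<times> nat \<times> nat \<Rightarrow> complex) \<times> (nat \<times> nat \<times> nat \<Rightarrow> complex)) measure" where
  "ginibre_space L M N =
     PiM ({1..M} \<times> {0..<N} \<times> {0..<N}) (\<lambda>_. std_complex_gaussian) \<Otimes>\<^sub>M
     PiM ({1..L} \<times> {0..<N} \<times> {0..<N}) (\<lambda>_. std_complex_gaussian)"

definition matrix_of :: "nat \<Rightarrow> (nat \<times> nat \<times> nat \<Rightarrow> complex) \<Rightarrow> nat \<Rightarrow> complex mat" where
  "matrix_of N x m = Matrix.mat N N (\<lambda>(a, b). x (m, a, b))"

text \<open>\<open>left_prod N A m = A m * \<dots> * A 1\<close>.\<close>

primrec left_prod :: "nat \<Rightarrow> (nat \<Rightarrow> complex mat) \<Rightarrow> nat \<Rightarrow> complex mat" where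
  "left_prod N A 0 = 1\<^sub>m N"
| "left_prod N A (Suc m) = A (Suc m) * left_prod N A m"

text \<open>The value on the null event where \<open>Y\<^sub>L \<cdots> Y\<^sub>1\<close> is singular is immaterial.\<close>

definition Pi_mat ::
  "nat \<Rightarrow> nat \<Rightarrow> nat \<Rightarrow> (nat \<times> nat \<times> nat \<Rightarrow> complex) \<times> (nat \<times> nat \<times> nat \<Rightarrow> complex) \<Rightarrow> complex mat" where
  "Pi_mat L M N \<omega> =
     (case mat_inverse (left_prod N (matrix_of N (snd \<omega>)) L) of
        None \<Rightarrow> 0\<^sub>m N N
      | Some B \<Rightarrow> B * left_prod N (matrix_of N (fst \<omega>)) M)"

text \<open>Eigenvalues are counted with algebraic multiplicity, as roots of the characteristic
  polynomial: the \<open>m\<close>-th copy of the eigenvalue \<open>a\<close> is labelled \<open>(a, m)\<close>. \<open>eigen_tuples n A B\<close>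
  is the number of ordered \<open>n\<close>-tuples of distinct labels whose tuple of eigenvalues lies in \<open>B\<close>.\<close>

definition eigen_labels :: "complex mat \<Rightarrow> (complex \<times> nat) set" where
  "eigen_labels A = {(a, m). m < Polynomial.order a (char_poly A)}"

definition eigen_tuples :: "nat \<Rightarrow> complex mat \<Rightarrow> (nat \<Rightarrow> complex) set \<Rightarrow> nat" where
  "eigen_tuples n A B =
     card {f \<in> {..<n} \<rightarrow>\<^sub>E eigen_labels A. inj_on f {..<n} \<and> (\<lambda>i\<in>{..<n}. fst (f i)) \<in> B}"

text \<open>\<open>R\<close> is an \<open>n\<close>-point correlation function of the eigenvalues of the random matrix \<open>A\<close>: the
  density, with respect to Lebesgue measure on \<open>n\<close>-tuples of complex numbers, of the
  \<open>n\<close>-th factorial moment measure. It is determined up to null sets only.\<close>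

definition eigen_correlation ::
  "'a measure \<Rightarrow> ('a \<Rightarrow> complex mat) \<Rightarrow> nat \<Rightarrow> ((nat \<Rightarrow> complex) \<Rightarrow> real) \<Rightarrow> bool" where
  "eigen_correlation P A n R \<longleftrightarrow>
     R \<in> borel_measurable (PiM {..<n} (\<lambda>_. lborel)) \<and>
     (\<forall>z. 0 \<le> R z) \<and>
     (\<forall>B \<in> sets (PiM {..<n} (\<lambda>_. lborel :: complex measure)).
        (\<integral>\<^sup>+ \<omega>. ennreal (real (eigen_tuples n (A \<omega>) B)) \<partial>P) =
        (\<integral>\<^sup>+ z \<in> B. ennreal (R z) \<partial>PiM {..<n} (\<lambda>_. lborel)))"

text \<open>The Mellin--Barnes weight along \<open>s = -c + \<i> y\<close>, \<open>ds = \<i> dy\<close>. The integrand takes conjugate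
  values at \<open>y\<close> and \<open>-y\<close>, so the integral is real and \<open>Re\<close> merely changes its type. At \<open>z = 0\<close>,
  where the integral is not meaningful, the convention \<open>0 powr s = 0\<close> gives the value 0.\<close>

definition weight :: "real \<Rightarrow> nat \<Rightarrow> nat \<Rightarrow> nat \<Rightarrow> complex \<Rightarrow> real" where
  "weight c L M N z =
     Re (LINT y|lborel.
           (let s = Complex (- c) y in
              Gamma (- s) ^ M * Gamma (of_nat N + s + 1) ^ L * complex_of_real (cmod z) powr (2 * s))
           * \<i> / (2 * complex_of_real pi * \<i>))"

definition corr_kernel :: "real \<Rightarrow> nat \<Rightarrow> nat \<Rightarrow> nat \<Rightarrow> complex \<Rightarrow> complex \<Rightarrow> complex" where
  "corr_kernel c L M N z1 z2 =
     complex_of_real (1 / pi * sqrt (weight c L M N z1 * weight c L M N z2)) *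
     (\<Sum>j<N. (z1 * cnj z2) ^ j /
        complex_of_real (Gamma (real j + 1) ^ M * Gamma (real N - real j) ^ L))"

definition rho :: "nat \<Rightarrow> nat \<Rightarrow> nat \<Rightarrow> nat \<Rightarrow> real" where
  "rho L M N k =
     2 * (real M * deriv Digamma (real N - real k + 1) + real L * deriv Digamma (real k)) powr (- 1 / 2)"

definition scaled_point ::
  "nat \<Rightarrow> nat \<Rightarrow> nat \<Rightarrow> nat \<Rightarrow> real \<Rightarrow> real \<Rightarrow> real \<Rightarrow> complex" where
  "scaled_point L M N k \<theta> v \<phi> =
     complex_of_real (exp (1 / 2 * (real M * Digamma (real N - real k + 1) - real L * Digamma (real k))
                           + v / rho L M N k)) *
     exp (\<i> * complex_of_real (\<theta> + \<phi>))"

end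

theory Submission
  imports Defs "HOL-Complex_Analysis.Complex_Analysis" "HOL-Real_Asymp.Real_Asymp"
begin

text \<open>Put \<open>a = N - k + 1\<close> and \<open>\<sigma>\<^sup>2 = M \<psi>'(a) + L \<psi>'(k)\<close>, so that \<open>\<rho> = 2 / \<sigma>\<close>; since \<open>\<psi>'(x) \<ge> 1 / x\<close>, we have
  \<open>\<sigma>\<^sup>2 \<ge> (L + M) / N \<rightarrow> \<infinity>\<close>. The contour of the weight can be moved through \<open>s = -a\<close>, a saddle point when
  \<open>v = 0\<close>. After the substitution \<open>y = u / \<sigma>\<close> the normalised integrand tends to \<open>exp (-u\<^sup>2 / 2)\<close> by
  Taylor expansion of \<open>ln \<Gamma>\<close>, and it is dominated by \<open>1 / (1 + u\<^sup>2 / 2)\<close> because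
  \<open>\<bar>\<Gamma>(x + \<i>y)\<bar>\<^sup>2 \<le> \<Gamma>(x)\<^sup>2 (1 + y\<^sup>2)\<close> to the power \<open>-\<psi>'(x)\<close> for \<open>x \<ge> 1\<close>. The extra factor
  \<open>exp (\<i>vu)\<close> does not affect the \<open>L\<^sup>1\<close> distance, whence uniformity in \<open>v\<close>. In the sum defining the
  kernel the term \<open>j = N - k\<close> dominates: convexity of \<open>ln \<Gamma>\<close> makes the term at distance \<open>m\<close> smaller by
  a factor \<open>exp (-m (\<sigma>\<^sup>2 / 8 - \<bar>v\<bar> \<sigma>))\<close>. Hence the rescaled kernel matrix converges, up to a unitary
  diagonal conjugation, to a matrix of rank one, whose determinant vanishes for \<open>n > 1\<close>.\<close>

section \<open>The Gamma function on vertical lines\<close>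

text \<open>Bernoulli's inequality for exponents in [0, 1], read off from convexity of
  \<open>exp\<close> on the segment from 0 to \<open>ln (1 + t)\<close>.\<close>

lemma powr_le_one_plus_mult:
  fixes b t :: real
  assumes "0 \<le> b" "b \<le> 1" "0 \<le> t"
  shows "(1 + t) powr b \<le> 1 + b * t"
proof -
  have "exp ((1 - b) *\<^sub>R 0 + b *\<^sub>R ln (1 + t)) \<le> (1 - b) * exp 0 + b * exp (ln (1 + t))"
    using convex_onD[OF exp_convex, of b 0 "ln (1+t)"] assms by auto
  then show ?thesis using assms by (simp add: powr_def algebra_simps)
qed

lemma Complex_notin_nonpos_Ints: "x > 0 \<Longrightarrow> Complex x y \<notin> \<int>\<^sub>\<le>\<^sub>0"
  by (auto simp: nonpos_Ints_def complex_eq_iff)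

lemma Complex_notin_nonpos_Reals: "x > 0 \<Longrightarrow> Complex x y \<notin> \<real>\<^sub>\<le>\<^sub>0"
  by (auto simp: complex_nonpos_Reals_iff)

text \<open>Each factor \<open>1 / (1 + y\<^sup>2 / (x + i)\<^sup>2)\<close> of the product for \<open>\<bar>\<Gamma>(x + \<i>y)\<bar>\<^sup>2 / \<Gamma>(x)\<^sup>2\<close> is
  estimated by Bernoulli's inequality with exponent \<open>1 / (x + i)\<^sup>2 \<le> 1\<close>; these exponents add up to
  \<open>\<psi>'(x)\<close>.\<close>

lemma norm_Gamma_series_sq_le:
  assumes x: "x \<ge> (1::real)"
  shows "(cmod (Gamma_series (Complex x y) n))\<^sup>2 \<le>
    (Gamma_series x n)\<^sup>2 * (1 + y\<^sup>2) powr (- (\<Sum>i<Suc n. inverse ((x + real i)\<^sup>2)))"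
proof -
  have fac: "inverse ((cmod (Complex x y + of_nat i))\<^sup>2)
      \<le> inverse ((x + real i)\<^sup>2) * (1 + y\<^sup>2) powr (- inverse ((x + real i)\<^sup>2))" for i
  proof -
    let ?b = "inverse ((x + real i)\<^sup>2)"
    have p: "(x + real i)\<^sup>2 \<ge> 1" using x by (simp add: one_le_power)
    have "(1 + y\<^sup>2) powr ?b \<le> 1 + ?b * y\<^sup>2"
      using p by (intro powr_le_one_plus_mult) (auto simp: inverse_le_1_iff)
    then have "(x + real i)\<^sup>2 * (1 + y\<^sup>2) powr ?b \<le> (x + real i)\<^sup>2 * (1 + ?b * y\<^sup>2)"
      using p by (intro mult_left_mono) auto
    also have "\<dots> = (x + real i)\<^sup>2 + y\<^sup>2"
      using p by (auto simp: field_simps)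
    also have "\<dots> = (cmod (Complex x y + of_nat i))\<^sup>2"
      by (simp add: cmod_power2)
    finally have "(x + real i)\<^sup>2 * (1 + y\<^sup>2) powr ?b \<le> (cmod (Complex x y + of_nat i))\<^sup>2" .
    moreover have "0 < (x + real i)\<^sup>2 * (1 + y\<^sup>2) powr ?b"
      using p by (intro mult_pos_pos) (auto simp: add_nonneg_eq_0_iff)
    ultimately have "inverse ((cmod (Complex x y + of_nat i))\<^sup>2) \<le> inverse ((x + real i)\<^sup>2 * (1 + y\<^sup>2) powr ?b)"
      by (rule le_imp_inverse_le)
    then show ?thesis by (simp add: powr_minus)
  qed
  have "(cmod (Gamma_series (Complex x y) n))\<^sup>2 =
     (fact n * exp (x * ln (real n)))\<^sup>2 * (\<Prod>i<Suc n. inverse ((cmod (Complex x y + of_nat i))\<^sup>2))"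
    by (simp add: Gamma_series_def pochhammer_prod norm_mult norm_divide norm_power prod_norm [symmetric]
       power_mult_distrib power_divide prod_dividef divide_inverse atLeast0LessThan power_inverse
       flip: prod_inversef prod_power_distrib del: prod.lessThan_Suc)
       (simp add: prod_power_distrib norm_inverse power_inverse del: prod.lessThan_Suc)
  also have "\<dots> \<le> (fact n * exp (x * ln (real n)))\<^sup>2 *
      (\<Prod>i<Suc n. inverse ((x + real i)\<^sup>2) * (1 + y\<^sup>2) powr (- inverse ((x + real i)\<^sup>2)))"
    by (intro mult_left_mono prod_mono conjI fac) auto
  also have "\<dots> = (Gamma_series x n)\<^sup>2 * (\<Prod>i<Suc n. (1 + y\<^sup>2) powr (- inverse ((x + real i)\<^sup>2)))"
    by (simp add: Gamma_series_def pochhammer_prod prod.distrib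
       power_mult_distrib power_divide divide_inverse atLeast0LessThan power_inverse
       flip: prod_inversef prod_power_distrib del: prod.lessThan_Suc)
       (simp add: prod_power_distrib power_inverse del: prod.lessThan_Suc)
  also have "(\<Prod>i<Suc n. (1 + y\<^sup>2) powr (- inverse ((x + real i)\<^sup>2))) =
      (1 + y\<^sup>2) powr (- (\<Sum>i<Suc n. inverse ((x + real i)\<^sup>2)))"
    by (subst powr_sum [symmetric]) (auto simp: sum_negf add_nonneg_eq_0_iff)
  finally show ?thesis .
qed

lemma Polygamma_1_sums:
  fixes x :: real assumes "x > 0"
  shows "(\<lambda>i. inverse ((x + real i)\<^sup>2)) sums Polygamma 1 x"
  using Polygamma_LIMSEQ[of x 1] assms by (simp add: numeral_2_eq_2)

text \<open>Limit of the bound for the finite products. The decay is kept as a power of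
  \<open>1 + y\<^sup>2\<close> because such exponents simply add when M-th and L-th powers of Gamma
  factors are multiplied, and they then add up to the square of \<open>spread\<close>.\<close>

lemma norm_Gamma_sq_le:
  assumes x: "x \<ge> (1::real)"
  shows "(cmod (Gamma (Complex x y)))\<^sup>2 \<le> (Gamma x)\<^sup>2 * (1 + y\<^sup>2) powr (- Polygamma 1 x)"
proof (rule LIMSEQ_le)
  show "(\<lambda>n. (cmod (Gamma_series (Complex x y) n))\<^sup>2) \<longlonglongrightarrow> (cmod (Gamma (Complex x y)))\<^sup>2"
    by (intro tendsto_intros)
  have "(\<lambda>n. \<Sum>i<Suc n. inverse ((x + real i)\<^sup>2)) \<longlonglongrightarrow> Polygamma 1 x"
    using Polygamma_1_sums[of x] x unfolding sums_def by (subst filterlim_sequentially_Suc) auto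
  then show "(\<lambda>n. (Gamma_series x n)\<^sup>2 * (1 + y\<^sup>2) powr (- (\<Sum>i<Suc n. inverse ((x + real i)\<^sup>2))))
     \<longlonglongrightarrow> (Gamma x)\<^sup>2 * (1 + y\<^sup>2) powr (- Polygamma 1 x)"
    by (intro tendsto_intros tendsto_powr) (auto simp: add_nonneg_eq_0_iff)
  show "\<exists>m. \<forall>n\<ge>m. (cmod (Gamma_series (Complex x y) n))\<^sup>2 \<le>
    (Gamma_series x n)\<^sup>2 * (1 + y\<^sup>2) powr (- (\<Sum>i<Suc n. inverse ((x + real i)\<^sup>2)))"
    using norm_Gamma_series_sq_le[OF x] by blast
qed

lemma norm_Gamma_Complex_le:
  assumes x: "x \<ge> (1::real)"
  shows "cmod (Gamma (Complex x y)) \<le> Gamma x"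
proof -
  have "x \<notin> \<int>\<^sub>\<le>\<^sub>0" using x by (auto elim!: nonpos_Ints_cases)
  then have "(1 + y\<^sup>2) powr (- Polygamma 1 x) \<le> (1 + y\<^sup>2) powr 0"
    using Polygamma_real_odd_pos[of x 1] by (intro powr_mono) auto
  also have "\<dots> \<le> 1" by simp
  finally have "(Gamma x)\<^sup>2 * (1 + y\<^sup>2) powr (- Polygamma 1 x) \<le> (Gamma x)\<^sup>2 * 1"
    by (intro mult_left_mono) auto
  with norm_Gamma_sq_le[OF x, of y] have "(cmod (Gamma (Complex x y)))\<^sup>2 \<le> (Gamma x)\<^sup>2"
    by simp
  then show ?thesis using x by (auto intro: power2_le_imp_le)
qed

text \<open>One step of the functional equation gains the factor
  \<open>1 / cmod (Complex x y)\<close> and moves the argument to real part above 1. This also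
  covers 0 < x < 1, which occurs on contours near the edges of the strip.\<close>

lemma norm_Gamma_Complex_decay:
  assumes x: "x > (0::real)"
  shows "cmod (Gamma (Complex x y)) \<le> Gamma (x + 1) / (min x 1 * sqrt (1 + y\<^sup>2))"
proof -
  have nz: "Complex x y \<noteq> 0" using x by (auto simp: complex_eq_iff)
  have "Gamma (Complex x y + 1) = Complex x y * Gamma (Complex x y)"
    using Complex_notin_nonpos_Ints[OF x] by (rule Gamma_plus1)
  then have "Gamma (Complex x y) = Gamma (Complex (x + 1) y) / Complex x y"
    using nz by (simp add: field_simps Complex_eq)
  then have eq: "cmod (Gamma (Complex x y)) = cmod (Gamma (Complex (x + 1) y)) / cmod (Complex x y)"
    by (simp add: norm_divide)
  have "(min x 1)\<^sup>2 \<le> x\<^sup>2" "(min x 1)\<^sup>2 \<le> 1"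
    using x by (auto intro!: power_mono power_le_one)
  moreover from this(2) have "(min x 1)\<^sup>2 * y\<^sup>2 \<le> 1 * y\<^sup>2"
    by (intro mult_right_mono) auto
  ultimately have "(min x 1 * sqrt (1 + y\<^sup>2))\<^sup>2 \<le> (cmod (Complex x y))\<^sup>2"
    by (simp add: power_mult_distrib cmod_power2 distrib_left)
  then have "min x 1 * sqrt (1 + y\<^sup>2) \<le> cmod (Complex x y)"
    by (rule power2_le_imp_le) auto
  moreover have "cmod (Gamma (Complex (x + 1) y)) \<le> Gamma (x + 1)"
    using x by (intro norm_Gamma_Complex_le) auto
  ultimately show ?thesis unfolding eq
    using x by (intro frac_le mult_pos_pos) (auto simp: add_pos_nonneg)
qed

section \<open>Second-order expansion of \<open>ln_Gamma\<close> along vertical lines\<close>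

lemma norm_Polygamma_2_le:
  assumes x: "x \<ge> (1::real)" and z: "Re z \<ge> x"
  shows "cmod (Polygamma 2 z) \<le> 2 * Polygamma 1 x"
proof -
  have nz: "z \<noteq> 0" using assms by auto
  have le: "norm (inverse ((z + of_nat i)^3)) \<le> inverse ((x + real i)\<^sup>2)" for i
  proof -
    have "1 \<le> x + real i" using x by auto
    have "x + real i \<le> Re (z + of_nat i)" using z by auto
    also have "\<dots> \<le> cmod (z + of_nat i)" by (rule complex_Re_le_cmod)
    finally have "(x + real i)^3 \<le> cmod (z + of_nat i) ^ 3"
      using x by (intro power_mono) auto
    moreover have "(x + real i)\<^sup>2 \<le> (x + real i)^3" using \<open>1 \<le> x + real i\<close>
      by (intro power_increasing) auto
    moreover have "0 < (x + real i)\<^sup>2" using \<open>1 \<le> x + real i\<close> by auto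
    ultimately show ?thesis
      by (simp add: norm_inverse norm_power le_imp_inverse_le)
  qed
  have sm: "summable (\<lambda>i. inverse ((x + real i)\<^sup>2))"
    using Polygamma_1_sums[of x] x by (auto simp: sums_iff)
  have "norm (\<Sum>i. inverse ((z + of_nat i)^3)) \<le> (\<Sum>i. inverse ((x + real i)\<^sup>2))"
    using sm le by (intro norm_suminf_le) auto
  also have "\<dots> = Polygamma 1 x"
    using Polygamma_1_sums[of x] x by (auto simp: sums_iff)
  finally show ?thesis
    by (simp add: Polygamma_def norm_mult numeral_3_eq_3)
qed

text \<open>Taylor expansion in the half-plane to the right of x: the linear term is a pure phase,
  the quadratic term is Gaussian, and the third derivative is at most
  \<open>2 * Polygamma 1 x\<close> there. That 2 cancels against the \<open>fact 2\<close> in the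
  remainder. Measuring the remainder by \<psi>'(x) too lets errors of many factors add up to a
  multiple of the squared spread.\<close>

lemma ln_Gamma_taylor:
  assumes x: "x \<ge> (1::real)"
  shows "cmod (ln_Gamma (Complex x y) - of_real (ln_Gamma x) - \<i> * of_real (y * Digamma x)
            + of_real (y\<^sup>2 / 2 * Polygamma 1 x)) \<le> \<bar>y\<bar> ^ 3 * Polygamma 1 x"
proof -
  define f where "f = (\<lambda>i::nat. if i = 0 then ln_Gamma else (Polygamma (i - 1) :: complex \<Rightarrow> complex))"
  have "cmod (f 0 (Complex x y) - (\<Sum>i\<le>2. f i (of_real x) * (Complex x y - of_real x) ^ i / fact i))
      \<le> (2 * Polygamma 1 x) * cmod (Complex x y - of_real x) ^ Suc 2 / fact 2"
  proof (rule complex_Taylor)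
    show "convex {z. Re z \<ge> x}" by (rule convex_halfspace_Re_ge)
    fix i z assume z: "z \<in> {z. x \<le> Re z}" and "i \<le> (2::nat)"
    have "z \<notin> \<real>\<^sub>\<le>\<^sub>0" "z \<notin> \<int>\<^sub>\<le>\<^sub>0"
      using z x Complex_notin_nonpos_Ints[of "Re z" "Im z"] Complex_notin_nonpos_Reals[of "Re z" "Im z"]
      by auto
    then show "(f i has_field_derivative f (Suc i) z) (at z within {z. x \<le> Re z})"
      unfolding f_def
      by (cases i) (auto intro!: has_field_derivative_ln_Gamma_complex has_field_derivative_Polygamma
          intro: has_field_derivative_at_within)
  next
    fix z assume "z \<in> {z. x \<le> Re z}"
    then show "cmod (f (Suc 2) z) \<le> 2 * Polygamma 1 x"
      using norm_Polygamma_2_le[OF x, of z] by (simp add: f_def)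
  qed auto
  also have "Complex x y - of_real x = \<i> * of_real y" by (simp add: complex_eq_iff)
  also have "(\<Sum>i\<le>2. f i (of_real x) * (\<i> * of_real y) ^ i / fact i) =
      of_real (ln_Gamma x) + \<i> * of_real (y * Digamma x) - of_real (y\<^sup>2 / 2 * Polygamma 1 x)"
    using x by (simp add: f_def numeral_2_eq_2 ln_Gamma_complex_of_real Polygamma_of_real power2_eq_square algebra_simps)
  finally show ?thesis
    by (simp add: f_def norm_mult algebra_simps power3_eq_cube)
qed

section \<open>Moving the contour of the weight\<close>

lemma integrable_one_plus_square: "integrable lborel (\<lambda>y::real. C / (1 + y\<^sup>2))"
proof -
  have "integrable lborel (\<lambda>y::real. C * inverse (1 + y\<^sup>2))"
    using integrable_inverse_1_plus_square by (intro integrable_mult_right) (simp add: set_integrable_def)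
  then show ?thesis by (simp add: divide_inverse)
qed

lemma integrable_of_decay:
  fixes f :: "real \<Rightarrow> complex"
  assumes "continuous_on UNIV f" "\<And>y. cmod (f y) \<le> C / (1 + y\<^sup>2)"
  shows "integrable lborel f"
proof (rule Bochner_Integration.integrable_bound[OF integrable_one_plus_square[of C]])
  show "f \<in> borel_measurable lborel"
    using assms(1) by (simp add: borel_measurable_continuous_onI)
  show "AE x in lborel. cmod (f x) \<le> norm (C / (1 + x\<^sup>2))"
    using order_trans[OF assms(2) abs_ge_self] by simp
qed

text \<open>A primitive P on the convex strip replaces the rectangle in Cauchy's theorem. Truncated
  integrals are differences of P at the ends of vertical segments, so the two lines differ only by
  increments of P along horizontal segments at heights n and -n, which vanish by the decay of
  f.\<close>

lemma vertical_integral_shift: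
  fixes f :: "complex \<Rightarrow> complex"
  assumes holo: "f holomorphic_on {s. a < Re s \<and> Re s < b}"
    and x1: "a < x1" "x1 < b" and x2: "a < x2" "x2 < b"
    and bound: "\<And>x y. x \<in> closed_segment x1 x2 \<Longrightarrow> cmod (f (Complex x y)) \<le> C / (1 + y\<^sup>2)"
  shows "(LINT y|lborel. f (Complex x1 y)) = (LINT y|lborel. f (Complex x2 y))"
proof -
  let ?S = "{s. a < Re s \<and> Re s < b}"
  have eqS: "?S = {s. a < Re s} \<inter> {s. Re s < b}" by auto
  have S: "convex ?S" "open ?S"
    unfolding eqS by (auto intro!: convex_Int convex_halfspace_Re_gt convex_halfspace_Re_lt
        open_Int open_halfspace_Re_gt open_halfspace_Re_lt)
  have "\<exists>P. \<forall>s\<in>?S. (P has_field_derivative f s) (at s within ?S)"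
  proof (rule holomorphic_convex_primitive'[OF S holo])
    fix g assume "\<And>s. s \<in> ?S \<Longrightarrow> (g has_field_derivative f s) (at s within ?S)"
    then show ?thesis by (intro exI[of _ g] ballI)
  qed
  then obtain P where P: "\<forall>s\<in>?S. (P has_field_derivative f s) (at s within ?S)" ..
  have P': "(P has_field_derivative f s) (at s)" if "s \<in> ?S" for s
    using P[rule_format, OF that] at_within_open[OF that S(2)] by metis
  have contf: "continuous_on ?S f" using holo by (rule holomorphic_on_imp_continuous_on)
  have conv: "(\<lambda>n. (P (Complex x (real n)) - P (Complex x (- real n))) / \<i>)
      \<longlonglongrightarrow> (LINT y|lborel. f (Complex x y))" if x: "x \<in> closed_segment x1 x2" for x
  proof -
    have xS: "Complex x y \<in> ?S" for y
      using x x1 x2 by (auto simp: closed_segment_eq_real_ivl split: if_splits)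
    have cont: "continuous_on A (\<lambda>y. f (Complex x y))" for A :: "real set"
      by (rule continuous_on_compose2[OF contf])
         (use xS in \<open>auto simp: Complex_eq intro!: continuous_intros\<close>)
    have int: "integrable lborel (\<lambda>y. f (Complex x y))"
      using cont bound[OF x] by (rule integrable_of_decay)
    \<comment> \<open>The path \<open>y \<mapsto> x + \<i>y\<close> has velocity \<i>, so the
      antiderivative in the real variable y is \<open>P / \<i>\<close>.\<close>
    have FTC: "(LINT y|lborel. indicator {- real n..real n} y *\<^sub>R f (Complex x y))
        = P (Complex x (real n)) / \<i> - P (Complex x (- real n)) / \<i>" for n
    proof (rule integral_FTC_Icc)
      fix y :: real
      have "((\<lambda>w. P (of_real x + w * \<i>)) has_field_derivative f (Complex x y) * \<i>) (at (of_real y))"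
      proof (rule DERIV_chain2[where f = P and g = "\<lambda>w. of_real x + w * \<i>"])
        show "(P has_field_derivative f (Complex x y)) (at (of_real x + of_real y * \<i>))"
          using P'[OF xS[of y]] by (simp add: Complex_eq mult.commute)
        show "((\<lambda>w. of_real x + w * \<i>) has_field_derivative \<i>) (at (of_real y))"
          by (auto intro!: derivative_eq_intros)
      qed
      from DERIV_cdivide[OF this, of \<i>]
      have "((\<lambda>w. P (of_real x + w * \<i>) / \<i>) has_field_derivative f (Complex x y)) (at (of_real y))"
        by (subst (asm) nonzero_mult_div_cancel_right) auto
      from has_vector_derivative_real_field[OF this]
      show "((\<lambda>y. P (Complex x y) / \<i>) has_vector_derivative f (Complex x y)) (at y within {- real n..real n})"
        by (simp add: Complex_eq mult.commute)
    qed (auto intro: cont)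
    have "(\<lambda>n. LINT y|lborel. indicator {- real n..real n} y *\<^sub>R f (Complex x y))
        \<longlonglongrightarrow> (LINT y|lborel. f (Complex x y))"
    proof (rule integral_dominated_convergence[where w = "\<lambda>y. cmod (f (Complex x y))"])
      show "AE y in lborel. (\<lambda>n. indicator {- real n..real n} y *\<^sub>R f (Complex x y)) \<longlonglongrightarrow> f (Complex x y)"
      proof (intro AE_I2 tendsto_eventually)
        fix y :: real
        show "\<forall>\<^sub>F n in sequentially. indicator {- real n..real n} y *\<^sub>R f (Complex x y) = f (Complex x y)"
          using eventually_ge_at_top[of "nat \<lceil>\<bar>y\<bar>\<rceil>"]
          by eventually_elim (auto simp: indicator_def abs_le_iff nat_le_iff ceiling_le_iff)
      qed
    qed (use int in \<open>auto simp: indicator_def intro!: borel_measurable_integrable\<close>)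
    then show ?thesis unfolding FTC diff_divide_distrib .
  qed
  \<comment> \<open>The sign s treats the upper and the lower horizontal segment at once. The mean
    value bound uses that f is at most \<open>C / (1 + n\<^sup>2)\<close> on the whole
    segment.\<close>
  have close: "(\<lambda>n. P (Complex x2 (s * real n)) - P (Complex x1 (s * real n))) \<longlonglongrightarrow> 0"
    if s: "s = 1 \<or> s = -1" for s :: real
  proof (rule Lim_null_comparison)
    show "\<forall>\<^sub>F n in sequentially. cmod (P (Complex x2 (s * real n)) - P (Complex x1 (s * real n)))
        \<le> C / (1 + (real n)\<^sup>2) * \<bar>x2 - x1\<bar>"
    proof (intro always_eventually allI)
      fix n
      let ?g = "\<lambda>x::real. Complex x (s * real n)"
      have s2: "(s * real n)\<^sup>2 = (real n)\<^sup>2" using s by auto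
      have "cmod (P (?g x2) - P (?g x1)) \<le> C / (1 + (real n)\<^sup>2) * cmod (?g x2 - ?g x1)"
      proof (rule field_differentiable_bound)
        show "convex (closed_segment (?g x1) (?g x2))" by simp
        fix z assume "z \<in> closed_segment (?g x1) (?g x2)"
        then obtain u where u: "0 \<le> u" "u \<le> 1" "z = (1 - u) *\<^sub>R ?g x1 + u *\<^sub>R ?g x2"
          by (auto simp: closed_segment_def)
        then have z: "z = ?g ((1 - u) * x1 + u * x2)" 
          by (simp add: complex_eq_iff algebra_simps)
        have sg: "(1 - u) * x1 + u * x2 \<in> closed_segment x1 x2"
          using u by (auto simp: closed_segment_def)
        then have "z \<in> ?S" using x1 x2 z
          by (auto simp: closed_segment_eq_real_ivl split: if_splits)
        from P'[OF this] show "(P has_field_derivative f z) (at z within closed_segment (?g x1) (?g x2))"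
          by (rule has_field_derivative_at_within)
        show "cmod (f z) \<le> C / (1 + (real n)\<^sup>2)"
          using bound[OF sg, of "s * real n"] by (simp add: z s2)
      qed auto
      also have "?g x2 - ?g x1 = of_real (x2 - x1)" by (simp add: complex_eq_iff)
      finally show "cmod (P (?g x2) - P (?g x1)) \<le> C / (1 + (real n)\<^sup>2) * \<bar>x2 - x1\<bar>"
        by (simp only: norm_of_real)
    qed
    show "(\<lambda>n. C / (1 + (real n)\<^sup>2) * \<bar>x2 - x1\<bar>) \<longlonglongrightarrow> 0"
      by (intro tendsto_mult_left_zero real_tendsto_divide_at_top[OF tendsto_const]) real_asymp
  qed
  have "(\<lambda>n. (P (Complex x2 (real n)) - P (Complex x2 (- real n))) / \<i> -
      (P (Complex x1 (real n)) - P (Complex x1 (- real n))) / \<i>)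
      \<longlonglongrightarrow> (LINT y|lborel. f (Complex x2 y)) - (LINT y|lborel. f (Complex x1 y))"
    by (intro tendsto_diff conv) auto
  moreover have "(\<lambda>n. ((P (Complex x2 (1 * real n)) - P (Complex x1 (1 * real n))) -
      (P (Complex x2 (-1 * real n)) - P (Complex x1 (-1 * real n)))) / \<i>) \<longlonglongrightarrow> (0 - 0) / \<i>"
    by (intro tendsto_intros close) auto
  then have "(\<lambda>n. (P (Complex x2 (real n)) - P (Complex x2 (- real n))) / \<i> -
      (P (Complex x1 (real n)) - P (Complex x1 (- real n))) / \<i>) \<longlonglongrightarrow> 0"
    by (simp add: diff_divide_distrib algebra_simps)
  ultimately have "(LINT y|lborel. f (Complex x2 y)) - (LINT y|lborel. f (Complex x1 y)) = 0"
    by (rule LIMSEQ_unique)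
  then show ?thesis by simp
qed

definition mellin_integrand :: "nat \<Rightarrow> nat \<Rightarrow> nat \<Rightarrow> real \<Rightarrow> complex \<Rightarrow> complex" where
  "mellin_integrand L M N r s =
     Gamma (- s) ^ M * Gamma (of_nat N + s + 1) ^ L * complex_of_real r powr (2 * s)"

lemma mellin_integrand_decay:
  assumes "L \<ge> 1" "M \<ge> 1" "r > 0" "0 < c" "c < real N + 1"
  shows "cmod (mellin_integrand L M N r (Complex (- c) y)) \<le>
    (Gamma (c + 1) / min c 1) ^ M * (Gamma (real N + 2 - c) / min (real N + 1 - c) 1) ^ L
      * r powr (- 2 * c) / (1 + y\<^sup>2)"
proof -
  define s where "s = sqrt (1 + y\<^sup>2)"
  have s: "s \<ge> 1" "s * s = 1 + y\<^sup>2" by (simp_all add: s_def)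
  \<comment> \<open>Since s is at least 1, one factor 1 / s may be kept from each of the two powers
    of Gamma functions. Together they give the integrable bound \<open>1 / (1 + y\<^sup>2)\<close>;
    here L and M must both be positive.\<close>
  have pw: "p ^ m \<le> q ^ m / s" if "0 \<le> p" "p \<le> q / s" "m \<ge> 1" "0 \<le> q" for p q m
  proof -
    have "p ^ m \<le> (q / s) ^ m" using that by (intro power_mono) auto
    also have "\<dots> = q ^ m / s ^ m" by (simp add: power_divide)
    also have "\<dots> \<le> q ^ m / s ^ 1" using that s
      by (intro divide_left_mono power_increasing) auto
    finally show ?thesis by simp
  qed
  let ?A = "(Gamma (c + 1) / min c 1) ^ M" and ?B = "(Gamma (real N + 2 - c) / min (real N + 1 - c) 1) ^ L"
  have e1: "- Complex (- c) y = Complex c (- y)" and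
    e2: "of_nat N + Complex (- c) y + 1 = Complex (real N + 1 - c) y"
    by (simp_all add: complex_eq_iff)
  have 1: "cmod (Gamma (- Complex (- c) y)) ^ M \<le> ?A / s"
    using norm_Gamma_Complex_decay[of c "- y"] assms unfolding e1
    by (intro pw) (auto simp: s_def)
  have 2: "cmod (Gamma (of_nat N + Complex (- c) y + 1)) ^ L \<le> ?B / s"
    using norm_Gamma_Complex_decay[of "real N + 1 - c" y] assms unfolding e2
    by (intro pw) (auto simp: s_def algebra_simps)
  have 3: "cmod (complex_of_real r powr (2 * Complex (- c) y)) = r powr (- 2 * c)"
    using assms by (simp add: norm_powr_real_powr)
  have "cmod (mellin_integrand L M N r (Complex (- c) y)) \<le> ?A / s * (?B / s) * r powr (- 2 * c)"
    unfolding mellin_integrand_def norm_mult norm_power 3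
    using assms by (intro mult_mono 1 2 mult_nonneg_nonneg) (auto simp: s_def)
  also have "\<dots> = ?A * ?B * r powr (- 2 * c) / (s * s)" by simp
  finally show ?thesis unfolding s .
qed

text \<open>The poles of \<open>Gamma (- s)\<close> start at s = 0 and go right, those of
  \<open>Gamma (N + s + 1)\<close> start at s = -(N + 1) and go left; the open strip between them is
  free of poles.\<close>

lemma mellin_integrand_holomorphic:
  assumes "r > 0"
  shows "mellin_integrand L M N r holomorphic_on {s. - (real N + 1) < Re s \<and> Re s < 0}"
proof -
  have "- s \<notin> \<int>\<^sub>\<le>\<^sub>0 \<and> of_nat N + s + 1 \<notin> \<int>\<^sub>\<le>\<^sub>0" if "- (real N + 1) < Re s" "Re s < 0" for s
    using that Complex_notin_nonpos_Ints[of "Re (- s)" "Im (- s)"]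
      Complex_notin_nonpos_Ints[of "Re (of_nat N + s + 1)" "Im (of_nat N + s + 1)"] 
    by (simp del: complex.sel uminus_complex.sel plus_complex.sel add: complex_surj) auto
  then show ?thesis unfolding mellin_integrand_def[abs_def]
    using assms by (intro holomorphic_intros) auto
qed

lemma weight_eq:
  "weight c L M N z = Re (LINT y|lborel. mellin_integrand L M N (cmod z) (Complex (- c) y)) / (2 * pi)"
proof -
  have "(LINT y|lborel.
           (let s = Complex (- c) y in
              Gamma (- s) ^ M * Gamma (of_nat N + s + 1) ^ L * complex_of_real (cmod z) powr (2 * s))
           * \<i> / (2 * complex_of_real pi * \<i>)) =
     (LINT y|lborel. mellin_integrand L M N (cmod z) (Complex (- c) y) / of_real (2 * pi))"
    by (intro Bochner_Integration.integral_cong) (auto simp: mellin_integrand_def Let_def)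
  also have "\<dots> = (LINT y|lborel. mellin_integrand L M N (cmod z) (Complex (- c) y)) / of_real (2 * pi)"
    by simp
  finally show ?thesis
    unfolding weight_def by (simp del: of_real_mult add: Re_divide_of_real)
qed

lemma continuous_on_Gamma_pos:
  fixes f :: "'a::topological_space \<Rightarrow> real"
  assumes "continuous_on A f" "\<And>x. x \<in> A \<Longrightarrow> f x > 0"
  shows "continuous_on A (\<lambda>x. Gamma (f x))"
proof (rule continuous_on_compose2[OF continuous_on_Gamma assms(1)])
  show "{0<..} \<inter> \<int>\<^sub>\<le>\<^sub>0 = ({} :: real set)" by (auto elim!: nonpos_Ints_cases)
qed (use assms(2) in auto)

text \<open>This frees the weight from the abscissa prescribed in its definition, so that the
  contour can be put through the saddle point.\<close>

lemma weight_shift: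
  assumes LM: "L \<ge> 1" "M \<ge> 1" and z: "z \<noteq> 0"
    and c: "0 < c" "c < real N + 1" and c': "0 < c'" "c' < real N + 1"
  shows "weight c L M N z = weight c' L M N z"
proof -
  define r where "r = cmod z"
  have r: "r > 0" using z by (simp add: r_def)
  \<comment> \<open>The constant in \<open>mellin_integrand_decay\<close> as a function of the
    abscissa x. It is continuous, and compactness of the segment gives one constant for all the
    vertical lines that are crossed.\<close>
  define h where "h = (\<lambda>x. (Gamma (- x + 1) / min (- x) 1) ^ M *
     (Gamma (real N + 2 + x) / min (real N + 1 + x) 1) ^ L * r powr (2 * x))"
  have seg: "- (real N + 1) < x \<and> x < 0" if "x \<in> closed_segment (- c) (- c')" for x
    using that c c' by (auto simp: closed_segment_eq_real_ivl split: if_splits)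
  have "continuous_on (closed_segment (- c) (- c')) h"
    unfolding h_def using r seg
    by (intro continuous_intros continuous_on_Gamma_pos ballI)
       (auto simp: min_def elim!: nonpos_Ints_cases dest!: seg split: if_splits)
  then have "compact (h ` closed_segment (- c) (- c'))"
    by (intro compact_continuous_image) auto
  then obtain C where C: "\<And>x. x \<in> closed_segment (- c) (- c') \<Longrightarrow> norm (h x) \<le> C"
    by (meson compact_imp_bounded bounded_iff imageI)
  have "(LINT y|lborel. mellin_integrand L M N r (Complex (- c) y)) =
        (LINT y|lborel. mellin_integrand L M N r (Complex (- c') y))"
  proof (rule vertical_integral_shift[OF mellin_integrand_holomorphic[OF r, of L M N]])
    fix x y assume x: "x \<in> closed_segment (- c) (- c')"
    have "cmod (mellin_integrand L M N r (Complex x y)) \<le> h x / (1 + y\<^sup>2)"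
      using mellin_integrand_decay[OF LM r, of "- x" N y] seg[OF x] by (simp add: h_def)
    also have "\<dots> \<le> C / (1 + y\<^sup>2)"
      using C[OF x] by (intro divide_right_mono) auto
    finally show "cmod (mellin_integrand L M N r (Complex x y)) \<le> C / (1 + y\<^sup>2)" .
  qed (use c c' in auto)
  then show ?thesis by (simp add: weight_eq r_def)
qed

section \<open>The weight near the saddle point\<close>

text \<open>Normalised to be 1 at y = 0 with the linear phase removed, so that its logarithm starts
  with the quadratic term.\<close>

definition Gamma_ratio :: "real \<Rightarrow> real \<Rightarrow> complex" where
  "Gamma_ratio x y = Gamma (Complex x y) / of_real (Gamma x) * exp (- (\<i> * of_real (y * Digamma x)))"

lemma Gamma_ratio_mult:
  assumes "x > 0"
  shows "Gamma (Complex x y) = of_real (Gamma x) * Gamma_ratio x y * exp (\<i> * of_real (y * Digamma x))"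
  using Gamma_real_pos[OF assms] by (simp add: Gamma_ratio_def exp_minus)

lemma norm_Gamma_ratio_sq_le:
  assumes "x \<ge> 1"
  shows "(cmod (Gamma_ratio x y))\<^sup>2 \<le> (1 + y\<^sup>2) powr (- Polygamma 1 x)"
proof -
  have "Gamma x > 0" using assms by (intro Gamma_real_pos) auto
  then have "(Gamma x)\<^sup>2 > 0" by simp
  moreover have "(cmod (Gamma_ratio x y))\<^sup>2 = (cmod (Gamma (Complex x y)))\<^sup>2 / (Gamma x)\<^sup>2"
    by (simp add: Gamma_ratio_def norm_mult norm_divide power_mult_distrib power_divide)
  ultimately show ?thesis
    using norm_Gamma_sq_le[OF assms, of y] by (simp add: divide_le_eq mult.commute)
qed

text \<open>Keeping the error inside the exponential means that integer powers merely multiply it,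
  without any choice of a branch of the logarithm.\<close>

lemma Gamma_ratio_exp:
  assumes x: "x \<ge> 1"
  obtains e where "Gamma_ratio x y = exp (- of_real (y\<^sup>2 / 2 * Polygamma 1 x) + e)"
    and "cmod e \<le> \<bar>y\<bar> ^ 3 * Polygamma 1 x"
proof
  let ?e = "ln_Gamma (Complex x y) - of_real (ln_Gamma x) - \<i> * of_real (y * Digamma x)
            + of_real (y\<^sup>2 / 2 * Polygamma 1 x)"
  show "cmod ?e \<le> \<bar>y\<bar> ^ 3 * Polygamma 1 x" by (rule ln_Gamma_taylor[OF x])
  have "Complex x y \<notin> \<int>\<^sub>\<le>\<^sub>0" using x by (intro Complex_notin_nonpos_Ints) auto
  then have "Gamma_ratio x y = exp (ln_Gamma (Complex x y)) / exp (of_real (ln_Gamma x))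
      * exp (- (\<i> * of_real (y * Digamma x)))"
    using x by (simp only: Gamma_ratio_def Gamma_complex_altdef if_False Gamma_real_pos_exp exp_of_real)
  also have "\<dots> = exp (- of_real (y\<^sup>2 / 2 * Polygamma 1 x) + ?e)"
    by (simp flip: exp_diff exp_add)
  finally show "Gamma_ratio x y = exp (- of_real (y\<^sup>2 / 2 * Polygamma 1 x) + ?e)" .
qed

lemma continuous_on_Gamma_ratio:
  assumes "x > 0" "continuous_on A f"
  shows "continuous_on A (\<lambda>u. Gamma_ratio x (f u))"
  unfolding Gamma_ratio_def
proof (intro continuous_intros assms(2))
  have "continuous_on {z. Re z > 0} (Gamma :: complex \<Rightarrow> complex)"
    using Complex_notin_nonpos_Ints[of "Re z" "Im z" for z] by (intro continuous_on_Gamma) auto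
  then show "continuous_on A (\<lambda>u. Gamma (Complex x (f u)))"
    by (rule continuous_on_compose2)
       (use assms in \<open>auto simp: Complex_eq intro!: continuous_intros\<close>)
qed (use Gamma_real_pos[OF assms(1), THEN less_imp_neq] in auto)

text \<open>Up to explicit factors, \<open>saddle_integral\<close> is the weight with the contour moved through the
  saddle point \<open>s = -a\<close>, where \<open>a = N - k + 1\<close>, and rescaled by \<open>spread = 2 / \<rho>\<close>.\<close>

definition spread :: "nat \<Rightarrow> nat \<Rightarrow> real \<Rightarrow> real \<Rightarrow> real" where
  "spread L M a k = sqrt (real M * Polygamma 1 a + real L * Polygamma 1 k)"

text \<open>The opposite signs come from the contour s = -a + \<i>y with a = N - k + 1, on which -s
  = a - \<i>y while N + s + 1 = k + \<i>y.\<close>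

definition saddle_integrand :: "nat \<Rightarrow> nat \<Rightarrow> real \<Rightarrow> real \<Rightarrow> real \<Rightarrow> complex" where
  "saddle_integrand L M a k u =
     Gamma_ratio a (- u / spread L M a k) ^ M * Gamma_ratio k (u / spread L M a k) ^ L"

definition saddle_integral :: "nat \<Rightarrow> nat \<Rightarrow> real \<Rightarrow> real \<Rightarrow> real \<Rightarrow> complex" where
  "saddle_integral L M a k v = (LINT u|lborel. saddle_integrand L M a k u * exp (\<i> * of_real (v * u)))"

lemma Polygamma_1_pos: "x > 0 \<Longrightarrow> Polygamma 1 (x::real) > 0"
  by (rule Polygamma_real_odd_pos) (auto elim!: nonpos_Ints_cases)

lemma spread_sq:
  assumes "a > 0" "k > 0"
  shows "(spread L M a k)\<^sup>2 = real M * Polygamma 1 a + real L * Polygamma 1 k"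
  using Polygamma_1_pos[of a] Polygamma_1_pos[of k] assms by (simp add: spread_def)

lemma spread_pos:
  assumes "a > 0" "k > 0" "L \<ge> 1" "M \<ge> 1"
  shows "spread L M a k > 0"
  unfolding spread_def using assms
  by (intro real_sqrt_gt_zero add_pos_pos mult_pos_pos Polygamma_1_pos) auto

text \<open>With s the squared spread, the exponents of all Gamma factors add up and bound the
  squared modulus by \<open>(1 + u\<^sup>2 / s) powr (- s)\<close>. Bernoulli's inequality with
  exponent 2 / s, which is at most 1 exactly when s is at least 2, makes this independent of
  s.\<close>

lemma norm_saddle_integrand_le:
  assumes a: "a \<ge> 1" and k: "k \<ge> 1" and \<sigma>: "(spread L M a k)\<^sup>2 \<ge> 2"
  shows "cmod (saddle_integrand L M a k u) \<le> 1 / (1 + u\<^sup>2 / 2)"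
proof -
  define s where "s = (spread L M a k)\<^sup>2"
  have s: "s \<ge> 2" "s = real M * Polygamma 1 a + real L * Polygamma 1 k"
    using \<sigma> spread_sq[of a k L M] a k by (auto simp: s_def)
  define y where "y = u / spread L M a k"
  have y2: "y\<^sup>2 = u\<^sup>2 / s" by (simp add: y_def s_def power_divide)
  have y0: "1 + y\<^sup>2 > 0" by (simp add: add_pos_nonneg)
  have "(cmod (saddle_integrand L M a k u))\<^sup>2 = ((cmod (Gamma_ratio a (- y)))\<^sup>2) ^ M * ((cmod (Gamma_ratio k y))\<^sup>2) ^ L"
    by (simp add: saddle_integrand_def y_def norm_mult norm_power power_mult_distrib mult.commute flip: power_mult)
  also have "\<dots> \<le> ((1 + y\<^sup>2) powr (- Polygamma 1 a)) ^ M * ((1 + y\<^sup>2) powr (- Polygamma 1 k)) ^ L"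
    using norm_Gamma_ratio_sq_le[OF a, of "- y"] norm_Gamma_ratio_sq_le[OF k, of y]
    by (intro mult_mono power_mono) auto
  also have "\<dots> = (1 + y\<^sup>2) powr (- s)"
  proof -
    have "((1 + y\<^sup>2) powr q) ^ m = (1 + y\<^sup>2) powr (q * real m)" for q m
      using y0 by (simp add: powr_realpow[symmetric] powr_powr)
    then show ?thesis by (simp only: s(2) powr_add[symmetric]) (simp add: algebra_simps)
  qed
  also have "\<dots> = 1 / (1 + u\<^sup>2 / s) powr s" by (simp add: powr_minus_divide y2)
  finally have 1: "(cmod (saddle_integrand L M a k u))\<^sup>2 \<le> 1 / (1 + u\<^sup>2 / s) powr s" .
  have "(1 + u\<^sup>2 / 2) powr (2 / s) \<le> 1 + 2 / s * (u\<^sup>2 / 2)"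
    using s(1) by (intro powr_le_one_plus_mult) auto
  then have "((1 + u\<^sup>2 / 2) powr (2 / s)) powr s \<le> (1 + u\<^sup>2 / s) powr s"
    using s(1) by (intro powr_mono2) auto
  then have 2: "(1 + u\<^sup>2 / 2)\<^sup>2 \<le> (1 + u\<^sup>2 / s) powr s"
    using s(1) by (simp add: powr_powr powr_numeral add_pos_nonneg)
  have "0 < (1 + u\<^sup>2 / 2)\<^sup>2" by (intro zero_less_power add_pos_nonneg) auto
  then have "(cmod (saddle_integrand L M a k u))\<^sup>2 \<le> 1 / (1 + u\<^sup>2 / 2)\<^sup>2"
    using order_trans[OF 1 frac_le[OF _ _ _ 2]] by simp
  also have "\<dots> = (1 / (1 + u\<^sup>2 / 2))\<^sup>2" by (simp add: power_divide)
  finally show ?thesis by (rule power2_le_imp_le) simp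
qed

text \<open>For y = u / \<sigma> with \<sigma> the spread, the quadratic terms add up to exactly
  \<open>u\<^sup>2 / 2\<close>, while the cubic remainders total at most
  \<open>\<bar>y\<bar> ^ 3 * \<sigma>\<^sup>2\<close>, that is
  \<open>\<bar>u\<bar> ^ 3 / \<sigma>\<close>.\<close>

lemma saddle_integrand_exp:
  assumes a: "a \<ge> 1" and k: "k \<ge> 1" and \<sigma>: "spread L M a k > 0"
  obtains e where "saddle_integrand L M a k u = exp (- of_real (u\<^sup>2 / 2) + e)"
    and "cmod e \<le> \<bar>u\<bar> ^ 3 / spread L M a k"
proof -
  let ?\<sigma> = "spread L M a k"
  let ?y = "u / ?\<sigma>"
  have s2: "?\<sigma>\<^sup>2 = real M * Polygamma 1 a + real L * Polygamma 1 k"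
    using spread_sq[of a k L M] a k by auto
  obtain e1 where e1: "Gamma_ratio a (- u / ?\<sigma>) = exp (- of_real ((- u / ?\<sigma>)\<^sup>2 / 2 * Polygamma 1 a) + e1)"
    "cmod e1 \<le> \<bar>- u / ?\<sigma>\<bar> ^ 3 * Polygamma 1 a"
    by (rule Gamma_ratio_exp[OF a])
  obtain e2 where e2: "Gamma_ratio k ?y = exp (- of_real (?y\<^sup>2 / 2 * Polygamma 1 k) + e2)"
    "cmod e2 \<le> \<bar>?y\<bar> ^ 3 * Polygamma 1 k"
    by (rule Gamma_ratio_exp[OF k])
  show ?thesis
  proof
    have "?y\<^sup>2 / 2 * (real M * Polygamma 1 a + real L * Polygamma 1 k) = u\<^sup>2 / 2"
      unfolding s2[symmetric] using \<sigma> by (simp add: power_divide)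
    then have E: "u\<^sup>2 / 2 = real M * (?y\<^sup>2 / 2 * Polygamma 1 a) + real L * (?y\<^sup>2 / 2 * Polygamma 1 k)"
      by (simp only: algebra_simps)
    have neg: "(- u / ?\<sigma>)\<^sup>2 = ?y\<^sup>2" by (simp add: power_divide)
    have gauss: "- complex_of_real (u\<^sup>2 / 2) = of_nat M * (- of_real ((- u / ?\<sigma>)\<^sup>2 / 2 * Polygamma 1 a))
       + of_nat L * (- of_real (?y\<^sup>2 / 2 * Polygamma 1 k))"
      unfolding neg E of_real_add of_real_mult[of "real M"] of_real_mult[of "real L"] of_real_of_nat_eq
      by (simp only: minus_add_distrib mult_minus_right)
    have "exp (A + e1) ^ M * exp (B + e2) ^ L =
        exp ((of_nat M * A + of_nat L * B) + (of_nat M * e1 + of_nat L * e2))" for A B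
      by (simp add: exp_of_nat_mult[symmetric] exp_add[symmetric] algebra_simps)
    then show "saddle_integrand L M a k u = exp (- of_real (u\<^sup>2 / 2) + (of_nat M * e1 + of_nat L * e2))"
      by (simp only: saddle_integrand_def e1(1) e2(1) gauss)
    have "cmod (of_nat M * e1 + of_nat L * e2) \<le> real M * cmod e1 + real L * cmod e2"
      by (rule order_trans[OF norm_triangle_ineq]) (simp add: norm_mult)
    also have "\<dots> \<le> real M * (\<bar>?y\<bar> ^ 3 * Polygamma 1 a) + real L * (\<bar>?y\<bar> ^ 3 * Polygamma 1 k)"
      using e1(2) e2(2) by (intro add_mono mult_left_mono) auto
    also have "\<dots> = \<bar>?y\<bar> ^ 3 * ?\<sigma>\<^sup>2" by (simp add: s2 algebra_simps)
    also have "\<dots> = \<bar>u\<bar> ^ 3 / ?\<sigma>"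
      using \<sigma> by (simp add: power_divide power3_eq_cube power2_eq_square)
    finally show "cmod (of_nat M * e1 + of_nat L * e2) \<le> \<bar>u\<bar> ^ 3 / ?\<sigma>" .
  qed
qed

lemma continuous_on_saddle_integrand:
  assumes "a > 0" "k > 0"
  shows "continuous_on A (saddle_integrand L M a k)"
  unfolding saddle_integrand_def using assms
  by (intro continuous_on_mult continuous_on_power continuous_on_Gamma_ratio)
     (auto simp: divide_inverse intro!: continuous_intros)

section \<open>Gaussian limit of the saddle integral\<close>

lemma integrable_gaussian: "integrable lborel (\<lambda>u::real. exp (- (u\<^sup>2 / 2)))"
proof -
  have "integrable lborel (\<lambda>u. sqrt (2 * pi) * std_normal_density u)"
    by (intro integrable_mult_right) auto
  then show ?thesis by (simp add: std_normal_density_def)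
qed

text \<open>Up to the normalisation 1 / sqrt (2 \<pi>) this is the characteristic function of the
  standard normal law.\<close>

lemma gaussian_fourier:
  "(LINT u|lborel. of_real (exp (- (u\<^sup>2 / 2))) * exp (\<i> * of_real (v * u)))
     = complex_of_real (sqrt (2 * pi) * exp (- (v\<^sup>2 / 2)))"
proof -
  have "char std_normal_distribution v = (LINT u|lborel. std_normal_density u *\<^sub>R exp (\<i> * of_real (v * u)))"
    unfolding char_def by (subst integral_density) (auto intro!: always_eventually)
  also have "\<dots> = (LINT u|lborel. of_real (1 / sqrt (2 * pi)) * (of_real (exp (- (u\<^sup>2 / 2))) * exp (\<i> * of_real (v * u))))"
    by (intro Bochner_Integration.integral_cong) (auto simp: std_normal_density_def scaleR_conv_of_real)
  also have "\<dots> = of_real (1 / sqrt (2 * pi)) * (LINT u|lborel. of_real (exp (- (u\<^sup>2 / 2))) * exp (\<i> * of_real (v * u)))"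
    by (rule integral_mult_right_zero)
  finally show ?thesis
    by (simp add: char_std_normal_distribution field_simps)
qed

lemma integrable_inverse_gaussian_bound: "integrable lborel (\<lambda>u::real. 1 / (1 + u\<^sup>2 / 2))"
proof (rule Bochner_Integration.integrable_bound[OF integrable_one_plus_square[of 2]])
  show "AE u in lborel. norm (1 / (1 + u\<^sup>2 / 2)) \<le> norm (2 / (1 + (u::real)\<^sup>2))"
    by (intro AE_I2) (auto simp: field_simps add_pos_nonneg)
qed simp

lemma saddle_integral_limit:
  fixes L M :: "nat \<Rightarrow> nat" and a k :: "nat \<Rightarrow> real"
  assumes a: "\<And>t. a t \<ge> 1" and k: "\<And>t. k t \<ge> 1"
    and \<sigma>: "filterlim (\<lambda>t. spread (L t) (M t) (a t) (k t)) at_top sequentially"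
  shows "uniform_limit UNIV (\<lambda>t v. saddle_integral (L t) (M t) (a t) (k t) v)
     (\<lambda>v. complex_of_real (sqrt (2 * pi) * exp (- (v\<^sup>2 / 2)))) sequentially"
proof -
  define G where "G = (\<lambda>t. saddle_integrand (L t) (M t) (a t) (k t))"
  define g where "g = (\<lambda>u::real. complex_of_real (exp (- (u\<^sup>2 / 2))))"
  have [measurable]: "G t \<in> borel_measurable borel" for t
    unfolding G_def using a[of t] k[of t]
    by (intro borel_measurable_continuous_onI continuous_on_saddle_integrand) auto
  have [measurable]: "g \<in> borel_measurable borel" unfolding g_def by measurable
  have lim: "(\<lambda>t. G t u) \<longlonglongrightarrow> g u" for u
  proof -
    have ev: "\<forall>\<^sub>F t in sequentially. 0 < spread (L t) (M t) (a t) (k t)"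
      using filterlim_at_top_dense[THEN iffD1, OF \<sigma>] by blast
    \<comment> \<open>For each t only the existence of an error term is known; the choice operator
      turns these into one sequence, which then tends to 0.\<close>
    define e where "e = (\<lambda>t. SOME e. G t u = exp (- of_real (u\<^sup>2 / 2) + e) \<and>
         cmod e \<le> \<bar>u\<bar> ^ 3 / spread (L t) (M t) (a t) (k t))"
    have e: "\<forall>\<^sub>F t in sequentially. G t u = exp (- of_real (u\<^sup>2 / 2) + e t) \<and>
         cmod (e t) \<le> \<bar>u\<bar> ^ 3 / spread (L t) (M t) (a t) (k t)"
      using ev
    proof eventually_elim
      case (elim t)
      obtain x where "G t u = exp (- of_real (u\<^sup>2 / 2) + x)" "cmod x \<le> \<bar>u\<bar> ^ 3 / spread (L t) (M t) (a t) (k t)"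
        unfolding G_def by (rule saddle_integrand_exp[OF a k elim])
      then show ?case unfolding e_def by (intro someI_ex[of "\<lambda>e. G t u = exp (- of_real (u\<^sup>2 / 2) + e) \<and>
         cmod e \<le> \<bar>u\<bar> ^ 3 / spread (L t) (M t) (a t) (k t)"]) blast
    qed
    have "e \<longlonglongrightarrow> 0"
    proof (rule Lim_null_comparison)
      show "\<forall>\<^sub>F t in sequentially. cmod (e t) \<le> \<bar>u\<bar> ^ 3 / spread (L t) (M t) (a t) (k t)"
        using e by eventually_elim simp
      show "(\<lambda>t. \<bar>u\<bar> ^ 3 / spread (L t) (M t) (a t) (k t)) \<longlonglongrightarrow> 0"
        by (rule real_tendsto_divide_at_top[OF tendsto_const \<sigma>])
    qed
    then have "(\<lambda>t. exp (- of_real (u\<^sup>2 / 2) + e t)) \<longlonglongrightarrow> exp (- of_real (u\<^sup>2 / 2) + 0)"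
      by (intro tendsto_intros)
    moreover have "exp (- of_real (u\<^sup>2 / 2) + 0) = g u"
      by (simp add: g_def flip: exp_of_real)
    moreover have "\<forall>\<^sub>F t in sequentially. exp (- of_real (u\<^sup>2 / 2) + e t) = G t u"
      using e by eventually_elim simp
    ultimately show ?thesis by (simp add: tendsto_cong)
  qed
  \<comment> \<open>From T on the squared spread is at least 4, which suffices for the dominating
    function. Dominated convergence is therefore applied to the sequence shifted by T.\<close>
  have "\<forall>\<^sub>F t in sequentially. spread (L t) (M t) (a t) (k t) \<ge> 2"
    using \<sigma> by (simp add: filterlim_at_top)
  then obtain T where T: "\<And>t. t \<ge> T \<Longrightarrow> spread (L t) (M t) (a t) (k t) \<ge> 2"
    by (auto simp: eventually_sequentially)
  have bd: "cmod (G t u) \<le> 1 / (1 + u\<^sup>2 / 2)" if "t \<ge> T" for t u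
  proof -
    have "2 ^ 2 \<le> (spread (L t) (M t) (a t) (k t))\<^sup>2" using T[OF that] by (intro power_mono) auto
    then show ?thesis unfolding G_def by (intro norm_saddle_integrand_le a k) auto
  qed
  have intg: "integrable lborel g"
    unfolding g_def using integrable_gaussian by (intro integrable_of_real)
  have intG: "integrable lborel (G t)" if "t \<ge> T" for t
    by (rule Bochner_Integration.integrable_bound[OF integrable_inverse_gaussian_bound])
       (use bd[OF that] in \<open>auto intro!: AE_I2 order_trans[OF _ abs_ge_self]\<close>)
  have "(\<lambda>i. LINT u|lborel. cmod (G (i + T) u - g u)) \<longlonglongrightarrow> (LINT u::real|lborel. cmod (0::complex))"
  proof (rule integral_dominated_convergence[where w = "\<lambda>u. 1 / (1 + u\<^sup>2 / 2) + exp (- (u\<^sup>2 / 2))"])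
    show "integrable lborel (\<lambda>u::real. 1 / (1 + u\<^sup>2 / 2) + exp (- (u\<^sup>2 / 2)))"
      by (intro Bochner_Integration.integrable_add integrable_inverse_gaussian_bound integrable_gaussian)
    show "AE u in lborel. (\<lambda>i. cmod (G (i + T) u - g u)) \<longlonglongrightarrow> cmod (0::complex)"
    proof (intro AE_I2 tendsto_norm)
      fix u
      show "(\<lambda>i. G (i + T) u - g u) \<longlonglongrightarrow> 0"
        using tendsto_diff[OF LIMSEQ_ignore_initial_segment[OF lim[of u], of T] tendsto_const[of "g u"]] by simp
    qed
    fix i
    show "AE u in lborel. norm (cmod (G (i + T) u - g u)) \<le> 1 / (1 + u\<^sup>2 / 2) + exp (- (u\<^sup>2 / 2))"
    proof (intro AE_I2)
      fix u
      have "cmod (G (i + T) u - g u) \<le> cmod (G (i + T) u) + cmod (g u)" by (rule norm_triangle_ineq4)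
      also have "cmod (G (i + T) u) \<le> 1 / (1 + u\<^sup>2 / 2)" by (rule bd) simp
      also have "cmod (g u) = exp (- (u\<^sup>2 / 2))" by (simp add: g_def)
      finally show "norm (cmod (G (i + T) u - g u)) \<le> 1 / (1 + u\<^sup>2 / 2) + exp (- (u\<^sup>2 / 2))" by simp
    qed
  qed simp_all
  then have L1: "(\<lambda>i. LINT u|lborel. cmod (G i u - g u)) \<longlonglongrightarrow> 0"
    by (rule LIMSEQ_offset[where k = T, OF tendsto_eq_rhs]) simp
  show ?thesis
  proof (rule uniform_limitI)
    fix \<epsilon> :: real assume "\<epsilon> > 0"
    then have "\<forall>\<^sub>F t in sequentially. (LINT u|lborel. cmod (G t u - g u)) < \<epsilon>"
      using L1 by (intro order_tendstoD(2)) auto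
    then show "\<forall>\<^sub>F t in sequentially. \<forall>v\<in>UNIV. dist (saddle_integral (L t) (M t) (a t) (k t) v)
       (complex_of_real (sqrt (2 * pi) * exp (- (v\<^sup>2 / 2)))) < \<epsilon>"
      using eventually_ge_at_top[of T]
    proof eventually_elim
      case (elim t)
      have int: "integrable lborel (\<lambda>u. h u * exp (\<i> * of_real (v * u)))"
        if "integrable lborel h" for h :: "real \<Rightarrow> complex" and v :: real
        by (rule Bochner_Integration.integrable_bound[OF that])
           (use that in \<open>auto simp: norm_mult intro!: AE_I2 borel_measurable_times borel_measurable_integrable\<close>)
      have "dist (saddle_integral (L t) (M t) (a t) (k t) v)
          (complex_of_real (sqrt (2 * pi) * exp (- (v\<^sup>2 / 2)))) < \<epsilon>" for v
      proof -
        have S: "saddle_integral (L t) (M t) (a t) (k t) v = (LINT u|lborel. G t u * exp (\<i> * of_real (v * u)))"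
          by (simp only: saddle_integral_def G_def)
        have F: "(LINT u|lborel. g u * exp (\<i> * of_real (v * u))) = complex_of_real (sqrt (2 * pi) * exp (- (v\<^sup>2 / 2)))"
          unfolding g_def by (rule gaussian_fourier)
        have "saddle_integral (L t) (M t) (a t) (k t) v - complex_of_real (sqrt (2 * pi) * exp (- (v\<^sup>2 / 2)))
          = (LINT u|lborel. G t u * exp (\<i> * of_real (v * u)) - g u * exp (\<i> * of_real (v * u)))"
          unfolding S F[symmetric]
          by (rule Bochner_Integration.integral_diff[symmetric]) (intro int intG intg elim)+
        also have "cmod \<dots> \<le> (LINT u|lborel. cmod (G t u * exp (\<i> * of_real (v * u)) - g u * exp (\<i> * of_real (v * u))))"
          by (rule integral_norm_bound)
        also have "\<dots> = (LINT u|lborel. cmod (G t u - g u))"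
          by (intro Bochner_Integration.integral_cong)
             (auto simp: norm_mult simp flip: left_diff_distrib)
        also have "\<dots> < \<epsilon>" by (rule elim)
        finally show ?thesis by (simp add: dist_norm)
      qed
      then show ?case by blast
    qed
  qed
qed

text \<open>The modulus of z is chosen so that 2 ln |z| cancels the linear phases
  \<open>- M * Digamma a + L * Digamma k\<close> of the Gamma factors and leaves only v times the
  spread. After y = u / \<sigma>, with \<sigma> the spread, v is the frequency of a Fourier
  integral.\<close>

lemma weight_saddle:
  assumes LM: "L \<ge> 1" "M \<ge> 1" and c: "0 < c" "c < real N + 1" and k: "k \<in> {1..N}"
    and a: "a = real N - real k + 1"
    and z: "cmod z = exp ((real M * Digamma a - real L * Digamma (real k) + v * spread L M a (real k)) / 2)"
  shows "weight c L M N z = Gamma a ^ M * Gamma (real k) ^ L * cmod z powr (- 2 * a)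
     / (2 * pi * spread L M a (real k)) * Re (saddle_integral L M a (real k) v)"
proof -
  let ?\<sigma> = "spread L M a (real k)"
  have a1: "a \<ge> 1" "real k \<ge> 1" "a < real N + 1" using a k by auto
  have \<sigma>: "?\<sigma> > 0" using a1 LM by (intro spread_pos) auto
  have r: "cmod z > 0" and z0: "z \<noteq> 0" using z by (auto simp del: zero_less_norm_iff)
  define C where "C = Gamma a ^ M * Gamma (real k) ^ L * cmod z powr (- 2 * a)"
  define h where "h = (\<lambda>y. Gamma_ratio a (- y) ^ M * Gamma_ratio k y ^ L * exp (\<i> * of_real (v * ?\<sigma> * y)))"
  have eq: "mellin_integrand L M N (cmod z) (Complex (- a) y) = of_real C * h y" for y
  proof -
    have e1: "- Complex (- a) y = Complex a (- y)" and
      e2: "of_nat N + Complex (- a) y + 1 = Complex (real k) y"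
      using a by (simp_all add: complex_eq_iff)
    have ln: "2 * ln (cmod z) = real M * Digamma a - real L * Digamma (real k) + v * ?\<sigma>"
      unfolding z by simp
    have "complex_of_real (cmod z) powr (2 * Complex (- a) y)
        = exp (of_real (- 2 * a * ln (cmod z)) + \<i> * of_real (y * (2 * ln (cmod z))))"
      using r by (simp add: powr_def Ln_of_real Complex_eq algebra_simps)
    also have "\<dots> = of_real (cmod z powr (- 2 * a)) * exp (\<i> * of_real (y * (2 * ln (cmod z))))"
      unfolding exp_add exp_of_real using r by (simp add: powr_def)
    finally have pw: "complex_of_real (cmod z) powr (2 * Complex (- a) y) =
       of_real (cmod z powr (- 2 * a)) * exp (\<i> * of_real (y * (2 * ln (cmod z))))" .
    have "exp (\<i> * of_real (- y * Digamma a)) ^ M * exp (\<i> * of_real (y * Digamma (real k))) ^ L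
        * exp (\<i> * of_real (y * (2 * ln (cmod z)))) = exp (\<i> * of_real (v * ?\<sigma> * y))"
      unfolding ln by (simp add: exp_of_nat_mult[symmetric] exp_add[symmetric] algebra_simps)
    moreover have "mellin_integrand L M N (cmod z) (Complex (- a) y) =
      of_real C * (Gamma_ratio a (- y) ^ M * Gamma_ratio k y ^ L *
       (exp (\<i> * of_real (- y * Digamma a)) ^ M * exp (\<i> * of_real (y * Digamma (real k))) ^ L
        * exp (\<i> * of_real (y * (2 * ln (cmod z))))))"
      unfolding mellin_integrand_def e1 e2 pw using a1
      by (simp add: Gamma_ratio_mult C_def power_mult_distrib)
    ultimately show ?thesis by (simp add: h_def)
  qed
  have "weight c L M N z = weight a L M N z"
    using a1 by (intro weight_shift LM z0 c) auto
  also have "\<dots> = Re (LINT y|lborel. of_real C * h y) / (2 * pi)"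
    unfolding weight_eq eq ..
  also have "(LINT y|lborel. of_real C * h y) = of_real C * (LINT y|lborel. h y)"
    by (rule integral_mult_right_zero)
  also have "(LINT y|lborel. h y) = \<bar>1 / ?\<sigma>\<bar> *\<^sub>R (LINT u|lborel. h (0 + 1 / ?\<sigma> * u))"
    using \<sigma> by (intro lborel_integral_real_affine) auto
  also have "(LINT u|lborel. h (0 + 1 / ?\<sigma> * u)) = saddle_integral L M a (real k) v"
    unfolding saddle_integral_def using \<sigma>
    by (intro Bochner_Integration.integral_cong) (auto simp: h_def saddle_integrand_def)
  finally show ?thesis using \<sigma> by (simp add: C_def)
qed

section \<open>The dominating term of the kernel\<close>

text \<open>Termwise, because x + 1 + i is at most 2 (x + i). It converts a Taylor remainder at x +
  1 back into a multiple of \<psi>'(x).\<close>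

lemma Polygamma_1_plus_one_ge:
  assumes x: "x \<ge> (1::real)"
  shows "Polygamma 1 x / 4 \<le> Polygamma 1 (x + 1)"
proof -
  have s1: "(\<lambda>i. inverse ((x + real i)\<^sup>2) / 4) sums (Polygamma 1 x / 4)"
    using x by (intro sums_divide Polygamma_1_sums) auto
  have s2: "(\<lambda>i. inverse ((x + 1 + real i)\<^sup>2)) sums Polygamma 1 (x + 1)"
    using x by (intro Polygamma_1_sums) auto
  show ?thesis
  proof (rule sums_le[OF _ s1 s2])
    fix i
    have "(x + 1 + real i)\<^sup>2 \<le> (2 * (x + real i))\<^sup>2" using x by (intro power_mono) auto
    moreover have "0 < (x + 1 + real i)\<^sup>2" using x by (intro zero_less_power) auto
    ultimately have "inverse ((2 * (x + real i))\<^sup>2) \<le> inverse ((x + 1 + real i)\<^sup>2)"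
      by (rule le_imp_inverse_le)
    then show "inverse ((x + real i)\<^sup>2) / 4 \<le> inverse ((x + 1 + real i)\<^sup>2)"
      unfolding power_mult_distrib inverse_mult_distrib by simp
  qed
qed

text \<open>Comparison of the series for \<psi>' with the telescoping sum of 1 / (x + i) - 1 / (x +
  i + 1). It provides the lower bound for the spread.\<close>

lemma inverse_le_Polygamma_1:
  assumes x: "x > (0::real)"
  shows "1 / x \<le> Polygamma 1 x"
proof (rule LIMSEQ_le)
  show "(\<lambda>n. 1 / x - 1 / (x + real n)) \<longlonglongrightarrow> 1 / x" by real_asymp
  show "(\<lambda>n. \<Sum>i<n. inverse ((x + real i)\<^sup>2)) \<longlonglongrightarrow> Polygamma 1 x"
    using Polygamma_1_sums[OF x] by (simp add: sums_def)
  have "1 / x - 1 / (x + real n) \<le> (\<Sum>i<n. inverse ((x + real i)\<^sup>2))" for n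
  proof (induction n)
    case (Suc n)
    have p: "x + real n > 0" using x by auto
    have "1 / (x + real n) - 1 / (x + real (Suc n)) = 1 / ((x + real n) * (x + real n + 1))"
      using p by (simp add: field_simps)
    also have "\<dots> \<le> 1 / ((x + real n) * (x + real n))"
      using p by (intro divide_left_mono mult_left_mono mult_pos_pos) auto
    also have "\<dots> = inverse ((x + real n)\<^sup>2)" by (simp add: power2_eq_square inverse_eq_divide)
    finally show ?case using Suc by simp
  qed simp
  then show "\<exists>n0. \<forall>n\<ge>n0. 1 / x - 1 / (x + real n) \<le> (\<Sum>i<n. inverse ((x + real i)\<^sup>2))"
    by blast
qed

lemma ln_Gamma_plus_one:
  assumes x: "x > (0::real)"
  shows "ln_Gamma (x + 1) = ln_Gamma x + ln x"
proof -
  have "x \<notin> \<int>\<^sub>\<le>\<^sub>0" using x by (auto elim!: nonpos_Ints_cases)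
  then have "Gamma (x + 1) = x * Gamma x" by (rule Gamma_plus1)
  then show ?thesis
    using x less_imp_neq[OF Gamma_real_pos[OF x]] by (simp add: ln_Gamma_real_pos ln_mult)
qed

text \<open>Second-order Taylor expansion of \<open>ln_Gamma\<close> on \<open>[x, x + 1]\<close>, at either end point.\<close>

lemma Digamma_ln_bounds:
  assumes x: "x > (0::real)"
  shows "Polygamma 1 (x + 1) / 2 \<le> ln x - Digamma x"
    and "Polygamma 1 (x + 1) / 2 \<le> Digamma (x + 1) - ln x"
proof -
  define f where "f = (\<lambda>i::nat. if i = 0 then ln_Gamma else (Polygamma (i - 1) :: real \<Rightarrow> real))"
  have der: "\<forall>m t. m < 2 \<and> x \<le> t \<and> t \<le> x + 1 \<longrightarrow> DERIV (f m) t :> f (Suc m) t"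
  proof (intro allI impI)
    fix m :: nat and t assume mt: "m < 2 \<and> x \<le> t \<and> t \<le> x + 1"
    then have "t \<notin> \<int>\<^sub>\<le>\<^sub>0" "t > 0" using x by (auto elim!: nonpos_Ints_cases)
    then show "DERIV (f m) t :> f (Suc m) t"
      unfolding f_def by (cases m) (auto intro: has_field_derivative_ln_Gamma_real has_field_derivative_Polygamma)
  qed
  \<comment> \<open>As \<psi>' decreases, the unknown intermediate point of the Taylor remainder can
    be replaced by the right end point.\<close>
  have anti: "Polygamma 1 (x + 1) \<le> Polygamma 1 t" if "x < t" "t < x + 1" for t
    using Polygamma_real_strict_antimono[of t "x + 1" 1] that x by simp
  obtain t where t: "x < t" "t < x + 1"
    "ln_Gamma (x + 1) = (\<Sum>m<2. f m x / fact m * (x + 1 - x) ^ m) + f 2 t / fact 2 * (x + 1 - x) ^ 2"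
    using Taylor_up[of 2 f ln_Gamma x "x + 1" x] der by (auto simp: f_def)
  have "ln_Gamma (x + 1) = ln_Gamma x + Digamma x + Polygamma 1 t / 2"
    unfolding t(3) by (simp add: f_def numeral_2_eq_2)
  then show "Polygamma 1 (x + 1) / 2 \<le> ln x - Digamma x"
    using anti[OF t(1,2)] ln_Gamma_plus_one[OF x] by simp
  obtain s where s: "x < s" "s < x + 1"
    "ln_Gamma x = (\<Sum>m<2. f m (x + 1) / fact m * (x - (x + 1)) ^ m) + f 2 s / fact 2 * (x - (x + 1)) ^ 2"
    using Taylor_down[of 2 f ln_Gamma x "x + 1" "x + 1"] der by (auto simp: f_def)
  have "ln_Gamma x = ln_Gamma (x + 1) - Digamma (x + 1) + Polygamma 1 s / 2"
    unfolding s(3) by (simp add: f_def numeral_2_eq_2)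
  then show "Polygamma 1 (x + 1) / 2 \<le> Digamma (x + 1) - ln x"
    using anti[OF s(1,2)] ln_Gamma_plus_one[OF x] by simp
qed

text \<open>Each unit step of \<open>ln_Gamma\<close> beyond x has increment at least
  \<open>ln x\<close>, which exceeds the slope \<psi>(x) by a fixed amount. The constant 1/8 is the
  1/2 of the Taylor remainder times the 1/4 lost in passing from \<psi>'(x + 1) to
  \<psi>'(x).\<close>

lemma ln_Gamma_gap_up:
  assumes x: "x \<ge> (1::real)"
  shows "ln_Gamma x + real m * Digamma x + real m * Polygamma 1 x / 8 \<le> ln_Gamma (x + real m)"
proof (induction m)
  case (Suc m)
  have "Digamma x + Polygamma 1 x / 8 \<le> ln x"
    using Digamma_ln_bounds(1)[of x] Polygamma_1_plus_one_ge[OF x] x by simp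
  also have "\<dots> \<le> ln (x + real m)" using x by simp
  also have "ln (x + real m) = ln_Gamma (x + real (Suc m)) - ln_Gamma (x + real m)"
    using ln_Gamma_plus_one[of "x + real m"] x by (simp add: add_ac)
  finally show ?case using Suc by (simp add: algebra_simps add_divide_distrib)
qed simp

text \<open>Downwards the expansion is taken at the right end point of [x - 1, x], so \<psi>'(x)
  appears directly; the resulting 1/2 is weakened to 1/8 to match the upward direction.\<close>

lemma ln_Gamma_gap_down:
  assumes "x - real m > (0::real)"
  shows "ln_Gamma x - real m * Digamma x + real m * Polygamma 1 x / 8 \<le> ln_Gamma (x - real m)"
  using assms
proof (induction m)
  case (Suc m)
  have x1: "x - 1 > 0" and p: "x - real m - 1 > 0" using Suc.prems by auto
  have "ln (x - real m - 1) \<le> ln (x - 1)" using p by simp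
  also have "\<dots> \<le> Digamma x - Polygamma 1 x / 8"
    using Digamma_ln_bounds(2)[OF x1] Polygamma_1_pos[of x] x1 by simp
  finally have "ln (x - real m - 1) \<le> Digamma x - Polygamma 1 x / 8" .
  moreover have "ln_Gamma (x - real m) = ln_Gamma (x - real (Suc m)) + ln (x - real m - 1)"
    using ln_Gamma_plus_one[OF p] by (simp add: algebra_simps)
  ultimately show ?case using Suc by (simp add: algebra_simps add_divide_distrib)
qed simp

lemma Gamma_quotient_le:
  fixes x d :: real
  assumes x: "x \<ge> 1" and d: "d \<in> \<int>" and xd: "x + d > 0"
  shows "Gamma x / Gamma (x + d) * exp (d * Digamma x) \<le> exp (- (\<bar>d\<bar> * Polygamma 1 x / 8))"
proof -
  obtain i where i: "d = of_int i" using d by (auto elim: Ints_cases)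
  have "ln_Gamma x + d * Digamma x + \<bar>d\<bar> * Polygamma 1 x / 8 \<le> ln_Gamma (x + d)"
  proof (cases "i \<ge> 0")
    case True
    then have "d = real (nat i)" using i by simp
    then show ?thesis using ln_Gamma_gap_up[OF x, of "nat i"] by simp
  next
    case False
    then have "d = - real (nat (- i))" using i by simp
    then show ?thesis using ln_Gamma_gap_down[of x "nat (- i)"] xd by simp
  qed
  then have "exp (ln_Gamma x - ln_Gamma (x + d) + d * Digamma x) \<le> exp (- (\<bar>d\<bar> * Polygamma 1 x / 8))"
    by simp
  then show ?thesis using x xd by (simp add: Gamma_real_pos_exp exp_add exp_diff)
qed

text \<open>The sum in the kernel divided by its term with index \<open>j = N - k\<close>.\<close>

definition kernel_sum :: "nat \<Rightarrow> nat \<Rightarrow> nat \<Rightarrow> nat \<Rightarrow> real \<Rightarrow> real \<Rightarrow> complex" where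
  "kernel_sum L M N k v \<phi> = (let a = real N - real k + 1 in \<Sum>j<N.
     of_real (Gamma a ^ M * Gamma (real k) ^ L / (Gamma (real j + 1) ^ M * Gamma (real N - real j) ^ L)
       * exp ((real j + 1 - a) * (real M * Digamma a - real L * Digamma (real k) + v * spread L M a (real k))))
     * exp (\<i> * of_real ((real j + 1 - a) * \<phi>)))"

text \<open>The exponents d M \<psi>(a) and -d L \<psi>(b) are the tangent slopes of the logarithms
  of the Gamma powers, so first-order terms cancel. What remains is the convexity gap, adding up to
  |d| times an eighth of the squared spread, against a loss of at most |d| C times the spread caused
  by v.\<close>

lemma kernel_sum_term_le:
  fixes a b d :: real
  assumes a: "a \<ge> 1" and b: "b \<ge> 1" and d: "d \<in> \<int>" "a + d > 0" "b - d > 0" and v: "\<bar>v\<bar> \<le> C"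
  shows "Gamma a ^ M * Gamma b ^ L / (Gamma (a + d) ^ M * Gamma (b - d) ^ L)
       * exp (d * (real M * Digamma a - real L * Digamma b + v * spread L M a b))
     \<le> exp (- (\<bar>d\<bar> * ((spread L M a b)\<^sup>2 / 8 - C * spread L M a b)))"
proof -
  let ?\<sigma> = "spread L M a b"
  have \<sigma>0: "?\<sigma> \<ge> 0" using Polygamma_1_pos[of a] Polygamma_1_pos[of b] a b by (simp add: spread_def)
  have s2: "?\<sigma>\<^sup>2 = real M * Polygamma 1 a + real L * Polygamma 1 b"
    using a b by (intro spread_sq) auto
  define A where "A = Gamma a / Gamma (a + d) * exp (d * Digamma a)"
  define B where "B = Gamma b / Gamma (b + (- d)) * exp ((- d) * Digamma b)"
  have A: "0 \<le> A" "A \<le> exp (- (\<bar>d\<bar> * Polygamma 1 a / 8))"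
    unfolding A_def using a d Gamma_quotient_le[OF a, of d] Gamma_real_pos[of a] Gamma_real_pos[of "a + d"] by auto
  have B: "0 \<le> B" "B \<le> exp (- (\<bar>d\<bar> * Polygamma 1 b / 8))"
    unfolding B_def using b d Gamma_quotient_le[OF b, of "- d"] Gamma_real_pos[of b] Gamma_real_pos[of "b - d"] by auto
  have "d * v \<le> \<bar>d\<bar> * \<bar>v\<bar>" by (simp add: abs_mult[symmetric])
  also have "\<dots> \<le> \<bar>d\<bar> * C" using v by (intro mult_left_mono) auto
  finally have "d * v * ?\<sigma> \<le> \<bar>d\<bar> * C * ?\<sigma>" using \<sigma>0 by (rule mult_right_mono)
  then have V: "exp (d * v * ?\<sigma>) \<le> exp (\<bar>d\<bar> * C * ?\<sigma>)" by simp
  have "Gamma a ^ M * Gamma b ^ L / (Gamma (a + d) ^ M * Gamma (b - d) ^ L)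
       * exp (d * (real M * Digamma a - real L * Digamma b + v * ?\<sigma>)) = A ^ M * B ^ L * exp (d * v * ?\<sigma>)"
  proof -
    have "exp (d * (real M * Digamma a - real L * Digamma b + v * ?\<sigma>))
        = exp (d * Digamma a) ^ M * exp ((- d) * Digamma b) ^ L * exp (d * v * ?\<sigma>)"
      by (simp add: exp_of_nat_mult[symmetric] exp_add[symmetric] algebra_simps)
    then show ?thesis
      by (simp add: A_def B_def power_mult_distrib power_divide)
  qed
  also have "\<dots> \<le> exp (- (\<bar>d\<bar> * Polygamma 1 a / 8)) ^ M * exp (- (\<bar>d\<bar> * Polygamma 1 b / 8)) ^ L
      * exp (\<bar>d\<bar> * C * ?\<sigma>)"
    using A B V by (intro mult_mono power_mono mult_nonneg_nonneg) auto
  also have "\<dots> = exp (- (\<bar>d\<bar> * (?\<sigma>\<^sup>2 / 8 - C * ?\<sigma>)))"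
    unfolding s2 by (simp add: exp_of_nat_mult[symmetric] exp_add[symmetric] field_simps)
  finally show ?thesis .
qed

lemma two_sided_geometric_le:
  fixes r :: real
  assumes r: "0 \<le> r" "r < 1" and p: "p < N"
  shows "(\<Sum>j\<in>{..<N} - {p}. r ^ nat \<bar>int j - int p\<bar>) \<le> 2 * (r / (1 - r))"
proof -
  have geo: "(\<Sum>i<m. r ^ Suc i) \<le> r / (1 - r)" for m
  proof -
    have "(\<Sum>i<m. r ^ Suc i) = r * (\<Sum>i<m. r ^ i)" by (simp add: sum_distrib_left)
    also have "(\<Sum>i<m. r ^ i) = (1 - r ^ m) / (1 - r)" using r by (simp add: sum_gp_strict)
    also have "r * \<dots> \<le> r * (1 / (1 - r))"
      using r by (intro mult_left_mono divide_right_mono) auto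
    finally show ?thesis by simp
  qed
  have split: "{..<N} - {p} = {..<p} \<union> {Suc p..<N}" using p by auto
  have 1: "(\<Sum>j<p. r ^ nat \<bar>int j - int p\<bar>) = (\<Sum>i<p. r ^ Suc i)"
  proof -
    have "(\<Sum>j<p. r ^ nat \<bar>int j - int p\<bar>) = (\<Sum>j<p. r ^ Suc (p - Suc j))"
      by (intro sum.cong arg_cong[where f = "\<lambda>m. r ^ m"]) auto
    also have "\<dots> = (\<Sum>i<p. r ^ Suc i)" by (rule sum.nat_diff_reindex)
    finally show ?thesis .
  qed
  have 2: "(\<Sum>j\<in>{Suc p..<N}. r ^ nat \<bar>int j - int p\<bar>) = (\<Sum>i<N - Suc p. r ^ Suc i)"
    unfolding sum.atLeastLessThan_shift_0[of _ "Suc p"] atLeast0LessThan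
    by (intro sum.cong) (auto simp: nat_add_distrib)
  have "(\<Sum>j\<in>{..<N} - {p}. r ^ nat \<bar>int j - int p\<bar>)
     = (\<Sum>j<p. r ^ nat \<bar>int j - int p\<bar>) + (\<Sum>j\<in>{Suc p..<N}. r ^ nat \<bar>int j - int p\<bar>)"
    unfolding split by (rule sum.union_disjoint) auto
  then show ?thesis using geo[of p] geo[of "N - Suc p"] unfolding 1 2 by linarith
qed

lemma kernel_sum_dist_one:
  assumes k: "k \<in> {1..N}" and v: "\<bar>v\<bar> \<le> C"
    and \<sigma>: "\<sigma> = spread L M (real N - real k + 1) (real k)" "\<sigma>\<^sup>2 / 8 - C * \<sigma> > 0"
    and r: "r = exp (- (\<sigma>\<^sup>2 / 8 - C * \<sigma>))"
  shows "cmod (kernel_sum L M N k v \<phi> - 1) \<le> 2 * (r / (1 - r))"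
proof -
  define a where "a = real N - real k + 1"
  define T where "T = (\<lambda>j::nat. Gamma a ^ M * Gamma (real k) ^ L / (Gamma (real j + 1) ^ M * Gamma (real N - real j) ^ L)
       * exp ((real j + 1 - a) * (real M * Digamma a - real L * Digamma (real k) + v * \<sigma>)))"
  define U where "U = (\<lambda>j::nat. of_real (T j) * exp (\<i> * of_real ((real j + 1 - a) * \<phi>)))"
  \<comment> \<open>The index of the dominating term. The sum starts at j = 0, so j + 1 = a and N -
    j = k hold together at j = N - k, and this term equals 1.\<close>
  define p where "p = N - k"
  have p: "p < N" "real p = a - 1" "a \<ge> 1" "real k \<ge> 1" using k by (auto simp: p_def a_def of_nat_diff)
  have S: "kernel_sum L M N k v \<phi> = (\<Sum>j<N. U j)"
    unfolding kernel_sum_def Let_def U_def T_def a_def \<sigma> ..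
  have e: "real p + 1 = a" "real N - real p = real k" using p by (auto simp: a_def)
  have "0 \<noteq> Gamma a" "0 \<noteq> Gamma (real k)" using p by (intro less_imp_neq Gamma_real_pos; simp)+
  then have "U p = 1" by (simp only: U_def T_def e) simp
  then have "kernel_sum L M N k v \<phi> - 1 = (\<Sum>j\<in>{..<N} - {p}. U j)"
    unfolding S using p by (subst sum.remove[of _ p]) auto
  also have "cmod \<dots> \<le> (\<Sum>j\<in>{..<N} - {p}. r ^ nat \<bar>int j - int p\<bar>)"
  proof (rule order_trans[OF norm_sum sum_mono])
    fix j assume j: "j \<in> {..<N} - {p}"
    define d where "d = real j - real p"
    have d: "d \<in> \<int>" "real j + 1 = a + d" "real N - real j = real k - d" "\<bar>d\<bar> = real (nat \<bar>int j - int p\<bar>)"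
      using p by (auto simp: d_def a_def)
    have "T j \<le> exp (- (\<bar>d\<bar> * (\<sigma>\<^sup>2 / 8 - C * \<sigma>)))"
      unfolding T_def d(2,3) \<sigma>(1) a_def[symmetric]
      using kernel_sum_term_le[OF p(3,4) d(1) _ _ v, of M L] j d(2,3) by (simp add: add_pos_nonneg) 
    also have "\<dots> = r ^ nat \<bar>int j - int p\<bar>"
      unfolding r d(4) exp_of_nat_mult[symmetric] by (simp only: mult_minus_right)
    finally have "T j \<le> r ^ nat \<bar>int j - int p\<bar>" .
    moreover have "0 \<le> T j" unfolding T_def using p j
      by (intro mult_nonneg_nonneg divide_nonneg_nonneg zero_le_power less_imp_le[OF Gamma_real_pos]) auto
    ultimately show "cmod (U j) \<le> r ^ nat \<bar>int j - int p\<bar>"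
      by (simp add: U_def norm_mult)
  qed
  also have "\<dots> \<le> 2 * (r / (1 - r))"
    using \<sigma>(2) p by (intro two_sided_geometric_le) (auto simp: r)
  finally show ?thesis .
qed

text \<open>The bound of \<open>kernel_sum_dist_one\<close> depends on C and the spread only, so a
  limit in one real variable yields uniformity in v and in all real \<phi>.\<close>

lemma kernel_sum_limit:
  fixes L M N k :: "nat \<Rightarrow> nat"
  assumes k: "\<And>t. k t \<in> {1..N t}"
    and \<sigma>: "filterlim (\<lambda>t. spread (L t) (M t) (real (N t) - real (k t) + 1) (real (k t))) at_top sequentially"
  shows "uniform_limit {(v, \<phi>). \<bar>v\<bar> \<le> C} (\<lambda>t (v, \<phi>). kernel_sum (L t) (M t) (N t) (k t) v \<phi>) (\<lambda>_. 1) sequentially"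
proof (rule uniform_limitI)
  fix \<epsilon> :: real assume \<epsilon>: "\<epsilon> > 0"
  define s where "s = (\<lambda>t. spread (L t) (M t) (real (N t) - real (k t) + 1) (real (k t)))"
  define f where "f = (\<lambda>x::real. exp (- (x\<^sup>2 / 8 - C * x)))"
  have "filterlim (\<lambda>x::real. x\<^sup>2 / 8 - C * x) at_top at_top" by real_asymp
  then have 1: "\<forall>\<^sub>F x in at_top. x\<^sup>2 / 8 - C * x > 0"
    unfolding filterlim_at_top_dense by blast
  have "((\<lambda>x. 2 * (f x / (1 - f x))) \<longlongrightarrow> 0) at_top" unfolding f_def by real_asymp
  then have 2: "\<forall>\<^sub>F x in at_top. 2 * (f x / (1 - f x)) < \<epsilon>" using \<epsilon> by (rule order_tendstoD)
  have "\<forall>\<^sub>F t in sequentially. (s t)\<^sup>2 / 8 - C * s t > 0 \<and> 2 * (f (s t) / (1 - f (s t))) < \<epsilon>"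
    using \<sigma>[folded s_def] eventually_conj[OF 1 2] by (auto simp: filterlim_iff)
  then show "\<forall>\<^sub>F t in sequentially. \<forall>x\<in>{(v, \<phi>). \<bar>v\<bar> \<le> C}.
     dist (case x of (v, \<phi>) \<Rightarrow> kernel_sum (L t) (M t) (N t) (k t) v \<phi>) 1 < \<epsilon>"
  proof eventually_elim
    case (elim t)
    have "cmod (kernel_sum (L t) (M t) (N t) (k t) v \<phi> - 1) < \<epsilon>" if "\<bar>v\<bar> \<le> C" for v \<phi>
      using kernel_sum_dist_one[OF k[of t] that, of "s t" "L t" "M t" "f (s t)" \<phi>] elim
      by (simp add: s_def f_def)
    then show ?case by (auto simp: dist_norm)
  qed
qed

text \<open>Both N - k + 1 and k lie between 1 and N, so \<psi>' is at least 1 / N at either point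
  however k varies.\<close>

lemma spread_at_top:
  fixes L M N k :: "nat \<Rightarrow> nat"
  assumes k: "\<And>t. k t \<in> {1..N t}"
    and ratio: "filterlim (\<lambda>t. (real (L t) + real (M t)) / real (N t)) at_top sequentially"
  shows "filterlim (\<lambda>t. spread (L t) (M t) (real (N t) - real (k t) + 1) (real (k t))) at_top sequentially"
proof (rule filterlim_at_top_mono)
  show "filterlim (\<lambda>t. sqrt ((real (L t) + real (M t)) / real (N t))) at_top sequentially"
    by (rule filterlim_compose[OF sqrt_at_top ratio])
  show "\<forall>\<^sub>F t in sequentially. sqrt ((real (L t) + real (M t)) / real (N t))
      \<le> spread (L t) (M t) (real (N t) - real (k t) + 1) (real (k t))"
  proof (intro always_eventually allI)
    fix t
    have P: "1 / real (N t) \<le> Polygamma 1 x" if "1 \<le> x" "x \<le> real (N t)" for x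
    proof -
      have "1 / real (N t) \<le> 1 / x" using that by (intro divide_left_mono) auto
      also have "\<dots> \<le> Polygamma 1 x" using that by (intro inverse_le_Polygamma_1) auto
      finally show ?thesis .
    qed
    have "(real (L t) + real (M t)) / real (N t) = real (M t) * (1 / real (N t)) + real (L t) * (1 / real (N t))"
      by (simp add: add_divide_distrib)
    also have "\<dots> \<le> real (M t) * Polygamma 1 (real (N t) - real (k t) + 1) + real (L t) * Polygamma 1 (real (k t))"
      using k[of t] by (intro add_mono mult_left_mono P) auto
    finally show "sqrt ((real (L t) + real (M t)) / real (N t))
      \<le> spread (L t) (M t) (real (N t) - real (k t) + 1) (real (k t))"
      unfolding spread_def by (rule real_sqrt_le_mono)
  qed
qed

section \<open>Determinants of rescaled kernels\<close>

lemma rho_eq: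
  assumes "k \<in> {1..N}"
  shows "rho L M N k = 2 / spread L M (real N - real k + 1) (real k)"
proof -
  let ?a = "real N - real k + 1"
  have p: "?a > 0" "real k > 0" using assms by auto
  have d: "deriv Digamma x = Polygamma 1 x" if "x > 0" for x :: real
  proof -
    have "x \<notin> \<int>\<^sub>\<le>\<^sub>0" using that by (auto elim!: nonpos_Ints_cases)
    then show ?thesis by (simp add: deriv_Polygamma)
  qed
  have half: "S powr (- 1 / 2) = 1 / sqrt S" if "S \<ge> 0" for S :: real
    using powr_minus_divide[of S "1 / 2"] powr_half_sqrt[OF that] by simp
  have "real M * Polygamma 1 ?a + real L * Polygamma 1 (real k) \<ge> 0"
    using Polygamma_1_pos[OF p(1)] Polygamma_1_pos[OF p(2)] by (intro add_nonneg_nonneg mult_nonneg_nonneg) auto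
  from half[OF this] show ?thesis
    unfolding rho_def spread_def d[OF p(1)] d[OF p(2)] by (simp only: times_divide_eq_right mult_1_right)
qed

text \<open>The unimodular factors make the leading term of the sum in the kernel independent of the
  arguments of the points; they cancel in the determinant.\<close>

lemma kernel_scaled:
  assumes LM: "L \<ge> 1" "M \<ge> 1" and c: "0 < c" "c < real N + 1" and k: "k \<in> {1..N}"
    and a: "a = real N - real k + 1"
    and W: "\<And>v. W v = Re (saddle_integral L M a (real k) v)"
    and z: "\<And>v \<phi>. z v \<phi> = scaled_point L M N k \<theta> v \<phi>"
  shows "of_real (cmod (z v1 \<phi>1) / rho L M N k) * exp (- (\<i> * of_real ((a - 1) * \<phi>1))) *
      (of_real (cmod (z v2 \<phi>2)) * exp (\<i> * of_real ((a - 1) * \<phi>2))) *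
      corr_kernel c L M N (z v1 \<phi>1) (z v2 \<phi>2)
    = of_real (1 / (4 * pi\<^sup>2) * sqrt (W v1 * W v2)) * kernel_sum L M N k ((v1 + v2) / 2) (\<phi>1 - \<phi>2)"
proof -
  define \<sigma> where "\<sigma> = spread L M a (real k)"
  define K where "K = Gamma a ^ M * Gamma (real k) ^ L"
  have a1: "a \<ge> 1" "real k \<ge> 1" using a k by auto
  have \<sigma>: "\<sigma> > 0" unfolding \<sigma>_def using a1 LM by (intro spread_pos) auto
  have K: "K > 0" unfolding K_def using a1
    by (intro mult_pos_pos zero_less_power Gamma_real_pos) auto
  have rho: "rho L M N k = 2 / \<sigma>" using rho_eq[OF k] by (simp add: \<sigma>_def a)
  define \<mu> where "\<mu> = real M * Digamma a - real L * Digamma (real k)"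
  define e where "e = (\<lambda>v. \<mu> / 2 + v * \<sigma> / 2)"
  have zeq: "z v \<phi> = of_real (exp (e v)) * exp (\<i> * of_real (\<theta> + \<phi>))" for v \<phi>
    using \<sigma> by (simp add: z scaled_point_def rho e_def \<mu>_def a)
  have nz: "cmod (z v \<phi>) = exp (e v)" for v \<phi>
    by (simp add: zeq norm_mult)
  have w: "weight c L M N (z v \<phi>) = K * exp (- 2 * a * e v) / (2 * pi * \<sigma>) * W v" for v \<phi>
  proof -
    have "cmod (z v \<phi>) = exp ((real M * Digamma a - real L * Digamma (real k) + v * spread L M a (real k)) / 2)"
      unfolding nz by (simp add: e_def \<mu>_def \<sigma>_def add_divide_distrib)
    from weight_saddle[OF LM c k a this] show ?thesis
      by (simp add: nz W K_def \<sigma>_def powr_def)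
  qed
  \<comment> \<open>The logarithm of |z1 z2|. It depends on v1 + v2 only, which is why the sum is
    evaluated at the midpoint of v1 and v2.\<close>
  define E where "E = e v1 + e v2"
  have E: "E = \<mu> + (v1 + v2) / 2 * \<sigma>" by (simp add: E_def e_def algebra_simps)
  have "weight c L M N (z v1 \<phi>1) * weight c L M N (z v2 \<phi>2)
      = (K * exp (- a * E) / (2 * pi * \<sigma>))\<^sup>2 * (W v1 * W v2)"
    unfolding w by (simp add: E_def power2_eq_square exp_add[symmetric] distrib_left mult_exp_exp algebra_simps)
  then have sq: "sqrt (weight c L M N (z v1 \<phi>1) * weight c L M N (z v2 \<phi>2))
      = K * exp (- a * E) / (2 * pi * \<sigma>) * sqrt (W v1 * W v2)"
    using K \<sigma> by (simp add: real_sqrt_mult abs_of_pos)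
  define \<phi> where "\<phi> = \<phi>1 - \<phi>2"
  have zz: "z v1 \<phi>1 * cnj (z v2 \<phi>2) = exp (of_real E + \<i> * of_real \<phi>)"
  proof -
    have "cnj (exp (\<i> * of_real (\<theta> + \<phi>2))) = exp (- (\<i> * of_real (\<theta> + \<phi>2)))"
      by (simp add: exp_cnj)
    then have "z v1 \<phi>1 * cnj (z v2 \<phi>2) = exp (of_real (e v1)) * exp (of_real (e v2)) *
        (exp (\<i> * of_real (\<theta> + \<phi>1)) * exp (- (\<i> * of_real (\<theta> + \<phi>2))))"
      by (simp add: zeq exp_of_real mult_ac)
    also have "\<dots> = exp (of_real E + \<i> * of_real \<phi>)"
      by (simp add: E_def \<phi>_def exp_add[symmetric] algebra_simps)
    finally show ?thesis .
  qed
  define g where "g = (\<lambda>j::nat. Gamma (real j + 1) ^ M * Gamma (real N - real j) ^ L)"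
  have "of_real (exp E * \<sigma> / 2) * exp (- (\<i> * of_real ((a - 1) * \<phi>))) *
      corr_kernel c L M N (z v1 \<phi>1) (z v2 \<phi>2)
    = of_real (exp E * \<sigma> / 2 * (1 / pi * (K * exp (- a * E) / (2 * pi * \<sigma>) * sqrt (W v1 * W v2)))) *
      (exp (- (\<i> * of_real ((a - 1) * \<phi>))) * (\<Sum>j<N. exp (of_real E + \<i> * of_real \<phi>) ^ j / of_real (g j)))"
    unfolding corr_kernel_def sq zz g_def by (simp only: of_real_mult mult_ac)
  \<comment> \<open>The constant collects 1/2 from \<open>rho\<close>, 1/\<pi> from the kernel and
    1/(2 \<pi>) from the weights. The factor exp ((1 - a) E) then joins exp (j E) in the sum to give
    the exponent j + 1 - a.\<close>
  also have "exp E * \<sigma> / 2 * (1 / pi * (K * exp (- a * E) / (2 * pi * \<sigma>) * sqrt (W v1 * W v2)))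
      = (1 / (4 * pi\<^sup>2) * sqrt (W v1 * W v2)) * (K * exp ((1 - a) * E))"
    using \<sigma> by (simp add: power2_eq_square left_diff_distrib exp_diff exp_minus field_simps)
  also have "of_real \<dots> * (exp (- (\<i> * of_real ((a - 1) * \<phi>))) * (\<Sum>j<N. exp (of_real E + \<i> * of_real \<phi>) ^ j / of_real (g j)))
     = of_real (1 / (4 * pi\<^sup>2) * sqrt (W v1 * W v2)) *
       (\<Sum>j<N. of_real (K * exp ((1 - a) * E)) * exp (- (\<i> * of_real ((a - 1) * \<phi>))) *
           (exp (of_real E + \<i> * of_real \<phi>) ^ j / of_real (g j)))"
    by (simp only: of_real_mult sum_distrib_left mult.assoc)
  also have "(\<Sum>j<N. of_real (K * exp ((1 - a) * E)) * exp (- (\<i> * of_real ((a - 1) * \<phi>))) *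
           (exp (of_real E + \<i> * of_real \<phi>) ^ j / of_real (g j)))
      = kernel_sum L M N k ((v1 + v2) / 2) \<phi>"
    unfolding kernel_sum_def Let_def a[symmetric]
  proof (rule sum.cong)
    fix j
    have "complex_of_real (exp ((1 - a) * E)) * exp (- (\<i> * of_real ((a - 1) * \<phi>))) *
           exp (of_real E + \<i> * of_real \<phi>) ^ j
        = exp (of_real ((real j + 1 - a) * E) + \<i> * of_real ((real j + 1 - a) * \<phi>))"
      by (simp add: exp_of_nat_mult[symmetric] exp_add[symmetric] exp_of_real[symmetric] algebra_simps)
    also have "\<dots> = of_real (exp ((real j + 1 - a) * E)) * exp (\<i> * of_real ((real j + 1 - a) * \<phi>))"
      unfolding exp_add exp_of_real ..
    finally have "complex_of_real (exp ((1 - a) * E)) * exp (- (\<i> * of_real ((a - 1) * \<phi>))) *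
           exp (of_real E + \<i> * of_real \<phi>) ^ j
        = of_real (exp ((real j + 1 - a) * E)) * exp (\<i> * of_real ((real j + 1 - a) * \<phi>))" (is "?lhs = ?rhs") .
    then have "of_real (K / g j) * ?lhs = of_real (K / g j) * ?rhs" by (simp only:)
    then have "of_real (K * exp ((1 - a) * E)) * exp (- (\<i> * of_real ((a - 1) * \<phi>))) *
           (exp (of_real E + \<i> * of_real \<phi>) ^ j / of_real (g j))
       = of_real (K / g j * exp ((real j + 1 - a) * E)) * exp (\<i> * of_real ((real j + 1 - a) * \<phi>))"
      by (simp only: of_real_mult of_real_inverse divide_inverse mult_ac)
    then show "of_real (K * exp ((1 - a) * E)) * exp (- (\<i> * of_real ((a - 1) * \<phi>))) *
           (exp (of_real E + \<i> * of_real \<phi>) ^ j / of_real (g j)) =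
       of_real (Gamma a ^ M * Gamma (real k) ^ L / (Gamma (real j + 1) ^ M * Gamma (real N - real j) ^ L)
       * exp ((real j + 1 - a) * (real M * Digamma a - real L * Digamma (real k) + (v1 + v2) / 2 * spread L M a (real k))))
     * exp (\<i> * of_real ((real j + 1 - a) * \<phi>))"
      unfolding K_def g_def E \<mu>_def \<sigma>_def .
  qed simp
  finally have main: "of_real (exp E * \<sigma> / 2) * exp (- (\<i> * of_real ((a - 1) * \<phi>))) *
      corr_kernel c L M N (z v1 \<phi>1) (z v2 \<phi>2)
    = of_real (1 / (4 * pi\<^sup>2) * sqrt (W v1 * W v2)) * kernel_sum L M N k ((v1 + v2) / 2) \<phi>" .
  have "of_real (cmod (z v1 \<phi>1) / rho L M N k) * exp (- (\<i> * of_real ((a - 1) * \<phi>1))) *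
      (of_real (cmod (z v2 \<phi>2)) * exp (\<i> * of_real ((a - 1) * \<phi>2)))
    = of_real (exp E * \<sigma> / 2) * (exp (- (\<i> * of_real ((a - 1) * \<phi>1))) * exp (\<i> * of_real ((a - 1) * \<phi>2)))"
    by (simp add: nz rho E_def exp_add)
  also have "exp (- (\<i> * of_real ((a - 1) * \<phi>1))) * exp (\<i> * of_real ((a - 1) * \<phi>2))
      = exp (- (\<i> * of_real ((a - 1) * \<phi>)))"
    by (simp add: \<phi>_def exp_add[symmetric] algebra_simps)
  finally show ?thesis using main by (simp only: \<phi>_def)
qed

section \<open>Leibniz expansion, scaling and uniform limits of determinants\<close>

lemma det_mat_Leibniz:
  fixes F :: "nat \<Rightarrow> nat \<Rightarrow> 'a :: comm_ring_1"
  shows "Determinant.det (Matrix.mat n n (\<lambda>(i, j). F i j))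
      = (\<Sum>p | p permutes {0..<n}. signof p * (\<Prod>i=0..<n. F i (p i)))"
  by (subst det_def') (auto intro!: sum.cong prod.cong dest: permutes_in_image)

text \<open>In each Leibniz term the product of the \<open>\<beta> (p i)\<close> is a reindexing of
  the product of the \<open>\<beta> i\<close>.\<close>

lemma det_scale_rows_columns:
  fixes K :: "nat \<Rightarrow> nat \<Rightarrow> 'a :: comm_ring_1"
  shows "Determinant.det (Matrix.mat n n (\<lambda>(i, j). \<alpha> i * \<beta> j * K i j))
     = (\<Prod>i<n. \<alpha> i * \<beta> i) * Determinant.det (Matrix.mat n n (\<lambda>(i, j). K i j))"
proof -
  have "(\<Prod>i=0..<n. \<alpha> i * \<beta> (p i) * K i (p i)) = (\<Prod>i<n. \<alpha> i * \<beta> i) * (\<Prod>i=0..<n. K i (p i))"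
    if "p permutes {0..<n}" for p
    using prod.permute[OF that, of \<beta>] by (simp add: prod.distrib atLeast0LessThan o_def)
  then show ?thesis unfolding det_mat_Leibniz sum_distrib_left
    by (intro sum.cong) (auto simp: mult_ac)
qed

lemma uniform_limit_sum:
  fixes f :: "'i \<Rightarrow> 't \<Rightarrow> 'x \<Rightarrow> 'b::real_normed_vector"
  assumes "\<And>i. i \<in> I \<Longrightarrow> uniform_limit X (f i) (l i) F"
  shows "uniform_limit X (\<lambda>t x. \<Sum>i\<in>I. f i t x) (\<lambda>x. \<Sum>i\<in>I. l i x) F"
  using assms
  by (induction I rule: infinite_finite_induct) (auto intro!: uniform_limit_intros)

lemma bounded_image_mult:
  fixes f g :: "'x \<Rightarrow> 'b::real_normed_algebra"
  assumes "bounded (f ` X)" "bounded (g ` X)"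
  shows "bounded ((\<lambda>x. f x * g x) ` X)"
proof -
  obtain A where A: "\<And>x. x \<in> X \<Longrightarrow> norm (f x) \<le> A"
    using assms(1) by (auto simp: bounded_iff)
  obtain B where B: "\<And>x. x \<in> X \<Longrightarrow> norm (g x) \<le> B"
    using assms(2) by (auto simp: bounded_iff)
  have "norm (f x * g x) \<le> A * B" if "x \<in> X" for x
    using A[OF that] B[OF that]
    by (intro order_trans[OF norm_mult_ineq] mult_mono) (auto intro: order_trans[OF norm_ge_zero])
  then show ?thesis by (auto simp: bounded_iff)
qed

text \<open>Boundedness of the limit is carried through the induction because uniform convergence of
  a product of two factors requires it.\<close>

lemma uniform_limit_prod:
  fixes f :: "'i \<Rightarrow> 't \<Rightarrow> 'x \<Rightarrow> complex"
  assumes "finite I" "\<And>i. i \<in> I \<Longrightarrow> uniform_limit X (f i) (l i) F"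
    "\<And>i. i \<in> I \<Longrightarrow> bounded (l i ` X)"
  shows "uniform_limit X (\<lambda>t x. \<Prod>i\<in>I. f i t x) (\<lambda>x. \<Prod>i\<in>I. l i x) F \<and> bounded ((\<lambda>x. \<Prod>i\<in>I. l i x) ` X)"
  using assms
proof (induction I rule: finite_induct)
  case empty
  show ?case by (auto intro!: uniform_limit_intros simp: bounded_iff)
next
  case (insert i I)
  have 1: "uniform_limit X (f i) (l i) F" "bounded (l i ` X)" using insert.prems by auto
  have 2: "uniform_limit X (\<lambda>t x. \<Prod>i\<in>I. f i t x) (\<lambda>x. \<Prod>i\<in>I. l i x) F"
    "bounded ((\<lambda>x. \<Prod>i\<in>I. l i x) ` X)" using insert.IH insert.prems by auto
  have "uniform_limit X (\<lambda>t x. f i t x * (\<Prod>i\<in>I. f i t x)) (\<lambda>x. l i x * (\<Prod>i\<in>I. l i x)) F"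
    using 1 2 by (intro uniform_lim_mult)
  moreover have "bounded ((\<lambda>x. l i x * (\<Prod>i\<in>I. l i x)) ` X)"
    using 1(2) 2(2) by (rule bounded_image_mult)
  ultimately show ?case using insert.hyps by simp
qed

lemma uniform_limit_det:
  fixes B :: "'t \<Rightarrow> 'x \<Rightarrow> nat \<Rightarrow> nat \<Rightarrow> complex"
  assumes lim: "\<And>i j. i < n \<Longrightarrow> j < n \<Longrightarrow> uniform_limit X (\<lambda>t x. B t x i j) (\<lambda>x. l x i j) F"
    and bdd: "\<And>i j. i < n \<Longrightarrow> j < n \<Longrightarrow> bounded ((\<lambda>x. l x i j) ` X)"
  shows "uniform_limit X (\<lambda>t x. Determinant.det (Matrix.mat n n (\<lambda>(i, j). B t x i j)))
     (\<lambda>x. Determinant.det (Matrix.mat n n (\<lambda>(i, j). l x i j))) F"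
proof -
  have "uniform_limit X (\<lambda>t x. signof p * (\<Prod>i=0..<n. B t x i (p i))) (\<lambda>x. signof p * (\<Prod>i=0..<n. l x i (p i))) F"
    if p: "p permutes {0..<n}" for p
  proof -
    have pin: "p i < n" if "i < n" for i using permutes_in_image[OF p, of i] that by auto
    have "uniform_limit X (\<lambda>t x. \<Prod>i=0..<n. B t x i (p i)) (\<lambda>x. \<Prod>i=0..<n. l x i (p i)) F"
      by (rule uniform_limit_prod[THEN conjunct1]) (auto intro!: lim bdd pin)
    then show ?thesis by (rule bounded_linear.uniform_limit[OF bounded_linear_mult_right])
  qed
  then show ?thesis unfolding det_mat_Leibniz by (intro uniform_limit_sum) auto
qed

text \<open>Before the limit the product under the root may be negative. It is eventually within 1
  of [0, C * C], and \<open>sqrt\<close>, which extends to negative reals as an odd continuous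
  function, is uniformly continuous on the enlarged compact interval.\<close>

lemma uniform_limit_sqrt_mult:
  fixes f :: "nat \<Rightarrow> real \<Rightarrow> real" and x y :: "'x \<Rightarrow> real"
  assumes lim: "uniform_limit UNIV f g sequentially" and g: "\<And>v. 0 \<le> g v \<and> g v \<le> C"
  shows "uniform_limit X (\<lambda>t p. sqrt (f t (x p) * f t (y p))) (\<lambda>p. sqrt (g (x p) * g (y p))) sequentially"
proof -
  have bdd: "bounded ((\<lambda>p. g (h p)) ` X)" for h :: "'x \<Rightarrow> real"
    using g by (intro boundedI[of _ C]) auto
  have prod: "uniform_limit X (\<lambda>t p. f t (x p) * f t (y p)) (\<lambda>p. g (x p) * g (y p)) sequentially"
    by (intro uniform_lim_mult bdd uniform_limit_compose'[OF lim]) auto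
  have gC: "0 \<le> g v * g w \<and> g v * g w \<le> C * C" for v w
    using g by (auto intro!: mult_mono mult_nonneg_nonneg order_trans[OF conjunct1[OF g[of v]] conjunct2[OF g[of v]]])
  show ?thesis
  proof (rule uniform_limit_compose_uniformly_continuous_on[OF prod])
    show "uniformly_continuous_on {-1..C * C + 1} sqrt"
      by (intro compact_uniformly_continuous continuous_intros) auto
    have "\<forall>\<^sub>F t in sequentially. \<forall>p\<in>X. dist (f t (x p) * f t (y p)) (g (x p) * g (y p)) < 1"
      using prod by (rule uniform_limitD) simp
    then show "\<forall>\<^sub>F t in sequentially. \<forall>p\<in>X. f t (x p) * f t (y p) \<in> {-1..C * C + 1}"
    proof eventually_elim
      case (elim t)
      show ?case
      proof
        fix p assume "p \<in> X"
        with elim have "\<bar>f t (x p) * f t (y p) - g (x p) * g (y p)\<bar> < 1" by (auto simp: dist_real_def)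
        then show "f t (x p) * f t (y p) \<in> {-1..C * C + 1}"
          using gC[of "x p" "y p"] unfolding atLeastAtMost_iff abs_less_iff by linarith
      qed
    qed
  qed simp
qed

text \<open>Extracting the row and column factors leaves the all-ones matrix, which has two equal
  rows as soon as n > 1.\<close>

lemma det_rank_one:
  fixes h :: "nat \<Rightarrow> 'a :: comm_ring_1"
  assumes "n \<ge> 1"
  shows "Determinant.det (Matrix.mat n n (\<lambda>(i, j). C * h i * h j)) = (if n = 1 then C * (h 0)\<^sup>2 else 0)"
proof -
  have "Determinant.det (Matrix.mat n n (\<lambda>(i, j). C * h i * h j * (1 :: 'a)))
      = (\<Prod>i<n. C * h i * h i) * Determinant.det (Matrix.mat n n (\<lambda>(i, j). 1 :: 'a))"
    by (rule det_scale_rows_columns)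
  moreover have "Determinant.det (Matrix.mat n n (\<lambda>(i, j). 1 :: 'a)) = 0" if "n > 1"
    by (rule det_identical_rows[of _ n 0 1]) (use that in \<open>auto simp: row_def\<close>)
  moreover have "Determinant.det (Matrix.mat 1 1 (\<lambda>(i, j). 1 :: 'a)) = 1"
    by (subst det_single) auto
  ultimately show ?thesis using assms
    by (cases "n = 1") (auto simp: power2_eq_square mult_ac)
qed

theorem theorem4p1:
  fixes L M N k :: "nat \<Rightarrow> nat"
    and c :: "nat \<Rightarrow> real"
    and n :: nat
    and R :: "nat \<Rightarrow> (nat \<Rightarrow> complex) \<Rightarrow> real"
    and \<theta> :: real
    and V :: "real set"
  assumes n: "n \<ge> 1"
    and pos: "\<And>t. L t \<ge> 1" "\<And>t. M t \<ge> 1" "\<And>t. N t \<ge> 1"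
    and to_infinity: "filterlim (\<lambda>t. L t + M t + N t) at_top sequentially"
    and ratio: "filterlim (\<lambda>t. (real (L t) + real (M t)) / real (N t)) at_top sequentially"
    and k: "\<And>t. k t \<in> {1..N t}"
    and c: "\<And>t. 0 < c t" "\<And>t. c t < real (N t) + 1"
    and \<theta>: "\<theta> \<in> {-pi<..pi}"
    and R_correlation:
      "\<And>t. eigen_correlation (ginibre_space (L t) (M t) (N t)) (Pi_mat (L t) (M t) (N t)) n (R t)"
    and R_determinantal:
      "\<And>t z. complex_of_real (R t z) =
         Determinant.det (Matrix.mat n n (\<lambda>(i, j). corr_kernel (c t) (L t) (M t) (N t) (z i) (z j)))"
    and V: "compact V"
  shows "uniform_limit
     {(v, \<phi>). (\<forall>j<n. v j \<in> V) \<and> (\<forall>j<n. \<phi> j \<in> {-pi<..pi})}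
     (\<lambda>t (v, \<phi>).
        let z = (\<lambda>j. scaled_point (L t) (M t) (N t) (k t) \<theta> (v j) (\<phi> j))
        in inverse (rho (L t) (M t) (N t) (k t)) ^ n * (cmod (\<Prod>j<n. z j))\<^sup>2 * R t z)
     (\<lambda>(v, \<phi>). if n = 1 then 1 / (sqrt (2 * pi)) ^ 3 * exp (- 1 / 2 * (v 0)\<^sup>2) else 0)
     sequentially"
proof -
  define X where "X = {(v, \<phi>). (\<forall>j<n. v j \<in> V) \<and> (\<forall>j<n. \<phi> j \<in> {-pi<..(pi::real)})}"
  define a where "a = (\<lambda>t. real (N t) - real (k t) + 1)"
  have a: "a t \<ge> 1" "real (k t) \<ge> 1" for t using k[of t] by (auto simp: a_def)
  define W where "W = (\<lambda>t v. Re (saddle_integral (L t) (M t) (a t) (real (k t)) v))"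
  define w where "w = (\<lambda>v. sqrt (2 * pi) * exp (- (v\<^sup>2 / 2)))"
  \<comment> \<open>The entries of the rescaled and conjugated kernel matrix in the form given by
    \<open>kernel_scaled\<close>, followed by their limits. The trailing factor 1 in
    \<open>l\<close> is the limit of \<open>kernel_sum\<close> and keeps the shape of a
    product.\<close>
  define B where "B = (\<lambda>t (p :: (nat \<Rightarrow> real) \<times> (nat \<Rightarrow> real)) i j.
     complex_of_real (1 / (4 * pi\<^sup>2) * sqrt (W t (fst p i) * W t (fst p j))) *
     kernel_sum (L t) (M t) (N t) (k t) ((fst p i + fst p j) / 2) (snd p i - snd p j))"
  define l where "l = (\<lambda>(p :: (nat \<Rightarrow> real) \<times> (nat \<Rightarrow> real)) i j.
     complex_of_real (1 / (4 * pi\<^sup>2) * sqrt (w (fst p i) * w (fst p j))) * 1)"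
  have \<sigma>: "filterlim (\<lambda>t. spread (L t) (M t) (a t) (real (k t))) at_top sequentially"
    unfolding a_def using k ratio by (rule spread_at_top)
  have W: "uniform_limit UNIV W w sequentially"
    using bounded_linear.uniform_limit[OF bounded_linear_Re saddle_integral_limit[OF a \<sigma>]]
    by (simp add: W_def w_def)
  have w: "0 \<le> w v \<and> w v \<le> sqrt (2 * pi)" for v
    by (auto simp: w_def intro!: mult_left_le)
  have sqrt_bdd: "bounded ((\<lambda>p. complex_of_real (1 / (4 * pi\<^sup>2) * sqrt (w (fst p i) * w (fst p j)))) ` X)" for i j
  proof (rule boundedI)
    fix x assume "x \<in> (\<lambda>p. complex_of_real (1 / (4 * pi\<^sup>2) * sqrt (w (fst p i) * w (fst p j)))) ` X"
    then obtain p where x: "x = complex_of_real (1 / (4 * pi\<^sup>2) * sqrt (w (fst p i) * w (fst p j)))" by auto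
    have "sqrt (w (fst p i) * w (fst p j)) \<le> sqrt (sqrt (2 * pi) * sqrt (2 * pi))"
      using w by (intro real_sqrt_le_mono mult_mono) auto
    then have "1 / (4 * pi\<^sup>2) * sqrt (w (fst p i) * w (fst p j)) \<le> 1 / (4 * pi\<^sup>2) * sqrt (sqrt (2 * pi) * sqrt (2 * pi))"
      by (intro mult_left_mono) auto
    moreover have "0 \<le> 1 / (4 * pi\<^sup>2) * sqrt (w (fst p i) * w (fst p j))"
      using w by (intro mult_nonneg_nonneg) auto
    ultimately show "norm x \<le> 1 / (4 * pi\<^sup>2) * sqrt (sqrt (2 * pi) * sqrt (2 * pi))"
      unfolding x norm_of_real by linarith
  qed
  obtain C where C: "\<And>v. v \<in> V \<Longrightarrow> \<bar>v\<bar> \<le> C"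
    using compact_imp_bounded[OF V] by (auto simp: bounded_iff)
  have B: "uniform_limit X (\<lambda>t p. B t p i j) (\<lambda>p. l p i j) sequentially" if ij: "i < n" "j < n" for i j
    unfolding B_def l_def
  proof (rule uniform_lim_mult)
    have "uniform_limit X (\<lambda>t p. sqrt (W t (fst p i) * W t (fst p j))) (\<lambda>p. sqrt (w (fst p i) * w (fst p j))) sequentially"
      using W w by (rule uniform_limit_sqrt_mult)
    then show "uniform_limit X (\<lambda>t p. complex_of_real (1 / (4 * pi\<^sup>2) * sqrt (W t (fst p i) * W t (fst p j))))
        (\<lambda>p. complex_of_real (1 / (4 * pi\<^sup>2) * sqrt (w (fst p i) * w (fst p j)))) sequentially"
      by (intro bounded_linear.uniform_limit[OF bounded_linear_of_real]
          bounded_linear.uniform_limit[OF bounded_linear_mult_right])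
    \<comment> \<open>A midpoint of two points of V may lie outside V, but it stays in
      [-C, C].\<close>
    have mid: "\<bar>(fst p i + fst p j) / 2\<bar> \<le> C" if "p \<in> X" for p
    proof -
      have "\<bar>fst p i\<bar> \<le> C" "\<bar>fst p j\<bar> \<le> C" using that ij by (auto simp: X_def intro!: C)
      then show ?thesis by (simp add: abs_le_iff)
    qed
    \<comment> \<open>Differences of two angles may leave the interval from -\<pi> to \<pi>; this is
      harmless since the limit is uniform in all real \<phi>.\<close>
    have "uniform_limit X (\<lambda>t p. case ((fst p i + fst p j) / 2, snd p i - snd p j) of
        (v, \<phi>) \<Rightarrow> kernel_sum (L t) (M t) (N t) (k t) v \<phi>) (\<lambda>_. 1) sequentially"
      by (rule uniform_limit_compose'[OF kernel_sum_limit[OF k \<sigma>[unfolded a_def], of C]]) (use mid in auto)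
    then show "uniform_limit X (\<lambda>t p. kernel_sum (L t) (M t) (N t) (k t) ((fst p i + fst p j) / 2) (snd p i - snd p j))
        (\<lambda>_. 1) sequentially" by simp
    show "bounded ((\<lambda>_. 1 :: complex) ` X)" by (intro boundedI[of _ 1]) auto
  qed (rule sqrt_bdd)
  have "uniform_limit X (\<lambda>t p. Re (Determinant.det (Matrix.mat n n (\<lambda>(i, j). B t p i j))))
     (\<lambda>p. Re (Determinant.det (Matrix.mat n n (\<lambda>(i, j). l p i j)))) sequentially"
    by (intro bounded_linear.uniform_limit[OF bounded_linear_Re] uniform_limit_det B)
       (use sqrt_bdd in \<open>simp_all add: l_def\<close>)
  moreover have "Re (Determinant.det (Matrix.mat n n (\<lambda>(i, j). B t p i j))) =
      (case p of (v, \<phi>) \<Rightarrow> let z = (\<lambda>j. scaled_point (L t) (M t) (N t) (k t) \<theta> (v j) (\<phi> j))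
        in inverse (rho (L t) (M t) (N t) (k t)) ^ n * (cmod (\<Prod>j<n. z j))\<^sup>2 * R t z)" for t p
  proof -
    define z where "z = (\<lambda>j. scaled_point (L t) (M t) (N t) (k t) \<theta> (fst p j) (snd p j))"
    let ?rho = "rho (L t) (M t) (N t) (k t)"
    \<comment> \<open>The factor 1 / \<open>rho\<close> is put into the rows only, so each index
      contributes it once and the modulus of \<open>z i\<close> twice. The phases of
      \<open>\<alpha> i\<close> and \<open>\<beta> i\<close> are inverse to each other.\<close>
    define \<alpha> where "\<alpha> = (\<lambda>i. of_real (cmod (z i) / ?rho) * exp (- (\<i> * of_real ((a t - 1) * snd p i))))"
    define \<beta> where "\<beta> = (\<lambda>i. of_real (cmod (z i)) * exp (\<i> * of_real ((a t - 1) * snd p i)))"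
    have "B t p i j = \<alpha> i * \<beta> j * corr_kernel (c t) (L t) (M t) (N t) (z i) (z j)" for i j
      unfolding B_def \<alpha>_def \<beta>_def z_def
      by (rule kernel_scaled[OF pos(1,2) c k a_def[THEN fun_cong] W_def[THEN fun_cong, THEN fun_cong] refl, symmetric])
    then have "Determinant.det (Matrix.mat n n (\<lambda>(i, j). B t p i j)) = (\<Prod>i<n. \<alpha> i * \<beta> i) * of_real (R t z)"
      unfolding R_determinantal by (simp only: det_scale_rows_columns)
    also have "(\<Prod>i<n. \<alpha> i * \<beta> i) = (\<Prod>i<n. of_real ((cmod (z i))\<^sup>2 * inverse ?rho))"
      by (intro prod.cong) (auto simp: \<alpha>_def \<beta>_def power2_eq_square exp_minus divide_inverse)
    also have "\<dots> = of_real (inverse ?rho ^ n * (cmod (\<Prod>j<n. z j))\<^sup>2)"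
      by (simp add: prod.distrib prod_norm[symmetric] prod_power_distrib mult.commute)
    finally have "Re (Determinant.det (Matrix.mat n n (\<lambda>(i, j). B t p i j)))
        = inverse ?rho ^ n * (cmod (\<Prod>j<n. z j))\<^sup>2 * R t z"
      unfolding of_real_mult[symmetric] by (simp only: Re_complex_of_real)
    then show ?thesis by (simp only: split_beta[of _ p] Let_def z_def)
  qed
  moreover have "Re (Determinant.det (Matrix.mat n n (\<lambda>(i, j). l p i j))) =
      (case p of (v, \<phi>) \<Rightarrow> if n = 1 then 1 / (sqrt (2 * pi)) ^ 3 * exp (- 1 / 2 * (v 0)\<^sup>2) else 0)" for p
  proof -
    \<comment> \<open>The geometric mean of two centred Gaussians splits into a function of v times
      the same function of v', so the limit matrix has the form treated in
      \<open>det_rank_one\<close>.\<close>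
    define h where "h = (\<lambda>i. complex_of_real (exp (- ((fst p i)\<^sup>2 / 4))))"
    define D where "D = complex_of_real (sqrt (2 * pi) / (4 * pi\<^sup>2))"
    have "sqrt (w v * w v') = sqrt (2 * pi) * (exp (- (v\<^sup>2 / 4)) * exp (- (v'\<^sup>2 / 4)))" for v v'
    proof (rule real_sqrt_unique)
      show "(sqrt (2 * pi) * (exp (- (v\<^sup>2 / 4)) * exp (- (v'\<^sup>2 / 4))))\<^sup>2 = w v * w v'"
        by (simp add: w_def power_mult_distrib exp_double[symmetric] power2_eq_square mult_exp_exp mult_ac)
    qed auto
    then have "l p i j = D * h i * h j" for i j
      unfolding l_def by (simp add: h_def D_def)
    then have "Determinant.det (Matrix.mat n n (\<lambda>(i, j). l p i j)) = (if n = 1 then D * (h 0)\<^sup>2 else 0)"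
      using det_rank_one[OF n, of D h] by simp
    also have "D * (h 0)\<^sup>2 = of_real (sqrt (2 * pi) / (4 * pi\<^sup>2) * exp (- 1 / 2 * (fst p 0)\<^sup>2))"
      by (simp add: D_def h_def exp_double[symmetric] flip: of_real_power of_real_mult)
    also have "sqrt (2 * pi) / (4 * pi\<^sup>2) = 1 / (sqrt (2 * pi)) ^ 3"
    proof -
      have "4 * pi\<^sup>2 = (sqrt (2 * pi)) ^ 4" 
        using power_mult[of "sqrt (2 * pi)" 2 2] by (simp add: power_mult_distrib)
      moreover have "s / s ^ 4 = 1 / s ^ 3" if "s > 0" for s :: real
        using that by (simp add: eval_nat_numeral)
      ultimately show ?thesis by simp
    qed
    finally have "Re (Determinant.det (Matrix.mat n n (\<lambda>(i, j). l p i j))) =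
        (if n = 1 then 1 / (sqrt (2 * pi)) ^ 3 * exp (- 1 / 2 * (fst p 0)\<^sup>2) else 0)"
      by (simp only: if_distrib[of Re] Re_complex_of_real zero_complex.sel)
    then show ?thesis by (simp only: split_beta[of _ p])
  qed
  ultimately show ?thesis unfolding X_def[symmetric] by (simp only:)
qed

end
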